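(* Let $d,m,n\ge 1$ be integers and $t\in\mathbb{R}$. Let $A:(H^{t/2}(\mathbb{R}^d))^m\to (H^{-t/2}(\mathbb{R}^d))^n$ be a continuous linear constant-coefficient operator with symbol matrix $M(\xi)\in\mathbb{C}^{n\times m}$. Let $\{\mathbf{\Psi}_{\ell,\mathbf{j}\mathbf{k}}\}$ be a wavelet basis with countable set $J$ of scale indices, as in the context, providing Riesz bases of the spaces $H^{\pm t/2}$; that is, the decompositions $\mathbf{v}\mapsto\underline{\mathbf{v}}$, $H^{\pm t/2}\to\ell^2_{\pm t/2}$, and the reconstructions $\underline{\mathbf{v}}\mapsto\mathbf{v}$, $\ell^2_{\pm t/2}\to H^{\pm t/2}$, are continuous. Suppose that for every $\mathbf{j}\in J$ a matrix $M_{\omega_{\mathbf{j}}}\in\mathbb{R}^{n\times m}$ is given such that $M_\omega^\dagger=\sum_{\mathbf{j}\in J}M_{\omega_{\mathbf{j}}}^\dagger P_{\mathbf{j}}$ is continuous from $(H^{-t/2}(\mathbb{R}^d))^n$ to $(H^{t/2}(\mathbb{R}^d))^m$. Suppose also that there is $\tilde B>0$ such that for all $\mathbf{v}\in (H^{-t/2}(\mathbb{R}^d))^n$, with $\mathbf{v}_{\mathbf{j}}=P_{\mathbf{j}}\mathbf{v}$, $$\|(\mathrm{Id}-A M_\omega^\dagger)\mathbf{v}\|_{H^{-t/2}}^2\le \tilde B\sum_{\mathbf{j}\in J}\|(\mathrm{Id}-A M_{\omega_{\mathbf{j}}}^\dagger)\mathbf{v}_{\mathbf{j}}\|_{H^{-t/2}}^2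 .$$ Suppose finally that there is a real number $\rho\ge 0$ such that $$\forall \mathbf{j}\in J,\ \forall \mathbf{v}_{\mathbf{j}}\in W_{\mathbf{j}},\qquad \|(\mathrm{Id}-A M_{\omega_{\mathbf{j}}}^\dagger)\mathbf{v}_{\mathbf{j}}\|_{H^{-t/2}}\le\rho\,\|\mathbf{v}_{\mathbf{j}}\|_{H^{-t/2}} .$$ Then, if $\rho$ is small enough (that is, if $\rho<\rho_0$ for some $\rho_0>0$ depending only on $\tilde B$ and on the wavelet basis and the space $H^{-t/2}$), for every $\mathbf{v}\in (H^{-t/2}(\mathbb{R}^d))^n$ the sequence $(\underline{\mathbf{u}}_p)_{p\in\mathbb{N}}$ defined by $$\underline{\mathbf{u}}_0=0,\quad \underline{\mathbf{v}}_0=\underline{\mathbf{v}},\quad \underline{\mathbf{u}}_{p+1}=\underline{\mathbf{u}}_p+\underline{M}_\omega^\dagger\,\underline{\mathbf{v}}_p,\quad \underline{\mathbf{v}}_{p+1}=\underline{\mathbf{v}}_p-\underline{A}(\underline{\mathbf{u}}_{p+1}-\underline{\mathbf{u}}_p)$$ converges in $\ell^2_{t/2}$ to the sequence $\underline{\mathbf{u}}$ of wavelet coefficients of some $\mathbf{u}\in (H^{t/2}(\mathbb{R}^d))^m$ such that $\underline{A}\,\underline{\mathbf{u}}=\underline{\mathbf{v}}$, i.e. $A\mathbf{u}=\mathbf{v}$.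
   Context: $H^s(\mathbb{R}^d)$ is the Sobolev space of tempered distributions $f$ with $(1+|\xi|^2)^{s/2}\widehat f\in L^2$, with its usual norm; $H^s$ also denotes its vector-valued powers. $A$ has symbol matrix $M(\xi)$ means $\widehat{A\mathbf{u}}(\xi)=M(\xi)\widehat{\mathbf{u}}(\xi)$. For a matrix $N$, $N^\dagger$ denotes its Moore–Penrose pseudo-inverse. Wavelet bases: $J$ is a countable set of scale indices (e.g. $\mathbb{Z}\times(\{0,1\}^d\setminus\{0\})$ for a multiresolution analysis, or $\mathbb{Z}^d$ for tensorial wavelets). For each $\ell=1,\dots,\max(m,n)$ one has a scalar wavelet family $\{\psi^\ell_{\mathbf{j}\mathbf{k}}\}_{\mathbf{j}\in J,\mathbf{k}\in\mathbb{Z}^d}$, and $\mathbf{\Psi}_{\ell,\mathbf{j}\mathbf{k}}=\psi^\ell_{\mathbf{j}\mathbf{k}}\,\mathbf{e}_\ell$, where $\mathbf{e}_\ell$ is the $\ell$-th canonical basis vector; $\ell$ ranges over $1,\dots,m$ when expanding elements of $(H^{t/2})^m$ and over $1,\dots,n$ when expanding elements of $(H^{-t/2})^n$. A vector function $\mathbf{v}$ is written $\mathbf{v}=\sum_{\ell,\mathbf{j},\mathbf{k}}v_{\ell\mathbf{j}\mathbf{k}}\mathbf{\Psi}_{\ell,\mathbf{j}\mathbf{k}}$, and $\underline{\mathbf{v}}=(v_{\ell\mathbf{j}\mathbf{k}})$ is its sequence of wavelet coefficients. Coefficient spaces: a function $\alpha:J\to\mathbb{R}$ is fixed (the scale; e.g.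 $\alpha(j,\varepsilon)=j$ for a multiresolution analysis, $\alpha(\mathbf{j})=\max_i j_i$ for tensorial wavelets), and $\|\underline{\mathbf{v}}\|_{\ell^2_s}^2=\sum_{\ell,\mathbf{j},\mathbf{k}}2^{2s\alpha(\mathbf{j})}|v_{\ell\mathbf{j}\mathbf{k}}|^2$. $W_{\mathbf{j}}$ is the closed span in $(H^{-t/2})^n$ of $\{\mathbf{\Psi}_{\ell,\mathbf{j}\mathbf{k}}:1\le\ell\le n,\ \mathbf{k}\in\mathbb{Z}^d\}$, and $P_{\mathbf{j}}$ is the projector onto $W_{\mathbf{j}}$ that keeps only the terms of scale index $\mathbf{j}$ in the wavelet expansion. The matrix $M_{\omega_{\mathbf{j}}}^\dagger\in\mathbb{R}^{m\times n}$ acts on $W_{\mathbf{j}}$ through the coefficients: it sends $\sum_{\ell,\mathbf{k}}v_{\ell\mathbf{j}\mathbf{k}}\mathbf{\Psi}_{\ell,\mathbf{j}\mathbf{k}}$ to $\sum_{\mathbf{k}}\sum_{\ell=1}^m\big(M_{\omega_{\mathbf{j}}}^\dagger(v_{1\mathbf{j}\mathbf{k}},\dots,v_{n\mathbf{j}\mathbf{k}})^T\big)_\ell\,\mathbf{\Psi}_{\ell,\mathbf{j}\mathbf{k}}$. $\underline{A}:\ell^2_{t/2}\to\ell^2_{-t/2}$ and $\underline{M}_\omega^\dagger:\ell^2_{-t/2}\to\ell^2_{t/2}$ denote the operators corresponding to $A$ and $M_\omega^\dagger$ through the wavelet decompositions and reconstructions. *)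

theory Defs
  imports
    "HOL-Analysis.Analysis"
    "HOL-Library.Function_Algebras"
    "Jordan_Normal_Form.Matrix"
begin

fun iter_partial :: "'d list \<Rightarrow> (real^'d::finite \<Rightarrow> complex) \<Rightarrow> (real^'d \<Rightarrow> complex)" where
  "iter_partial [] \<phi> = \<phi>"
| "iter_partial (i # is) \<phi> =
     (\<lambda>x. frechet_derivative (iter_partial is \<phi>) (at x) (axis i 1))"

text \<open>Frechet differentiability of all iterated partial derivatives amounts to smoothness.\<close>

definition schwartz :: "(real^'d::finite \<Rightarrow> complex) set" where
  "schwartz = {\<phi>. \<forall>is. (\<forall>x. iter_partial is \<phi> differentiable (at x)) \<and>
     (\<forall>N. bdd_above (range (\<lambda>x. (1 + norm x) ^ N * cmod (iter_partial is \<phi> x))))}"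

definition schwartz_seminorm :: "nat \<Rightarrow> 'd list \<Rightarrow> (real^'d::finite \<Rightarrow> complex) \<Rightarrow> real" where
  "schwartz_seminorm N is \<phi> = (SUP x. (1 + norm x) ^ N * cmod (iter_partial is \<phi> x))"

text \<open>A distribution is a functional on the Schwartz space. Since HOL functions are total, the
  value outside the Schwartz space is fixed to be 0, so that equality of functionals is equality
  of distributions.\<close>

type_synonym 'd tdist = "(real^'d \<Rightarrow> complex) \<Rightarrow> complex"

definition tempered :: "('d::finite) tdist set" where
  "tempered = {T.
     (\<forall>\<phi>. \<phi> \<notin> schwartz \<longrightarrow> T \<phi> = 0) \<and>
     (\<forall>\<phi>\<in>schwartz. \<forall>\<eta>\<in>schwartz. T (\<lambda>x. \<phi> x + \<eta> x) = T \<phi> + T \<eta>) \<and>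
     (\<forall>c. \<forall>\<phi>\<in>schwartz. T (\<lambda>x. c * \<phi> x) = c * T \<phi>) \<and>
     (\<exists>C N. \<forall>\<phi>\<in>schwartz.
        cmod (T \<phi>) \<le> C * (\<Sum>is\<in>{is. length is \<le> N}. schwartz_seminorm N is \<phi>))}"

definition fourier :: "(real^'d::finite \<Rightarrow> complex) \<Rightarrow> real^'d \<Rightarrow> complex" where
  "fourier \<phi> \<xi> = (\<integral>x. cis (- inner x \<xi>) * \<phi> x \<partial>lborel)"

text \<open>The Fourier transform of a tempered distribution \<open>T\<close> is \<open>\<phi> \<mapsto> T (fourier \<phi>)\<close>;
  \<open>has_fourier T g\<close> says that this distribution is the function \<open>g\<close>.
  Such a \<open>g\<close> is unique up to null sets.\<close>

definition has_fourier :: "('d::finite) tdist \<Rightarrow> (real^'d \<Rightarrow> complex) \<Rightarrow> bool" where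
  "has_fourier T g \<longleftrightarrow> g \<in> borel_measurable borel \<and>
     (\<forall>\<phi>\<in>schwartz. integrable lborel (\<lambda>\<xi>. g \<xi> * \<phi> \<xi>) \<and>
        T (fourier \<phi>) = (\<integral>\<xi>. g \<xi> * \<phi> \<xi> \<partial>lborel))"

definition fhat :: "('d::finite) tdist \<Rightarrow> real^'d \<Rightarrow> complex" where
  "fhat T = (SOME g. has_fourier T g)"

definition sobolev :: "real \<Rightarrow> ('d::finite) tdist set" where
  "sobolev s = {T\<in>tempered. \<exists>g. has_fourier T g \<and>
     integrable lborel (\<lambda>\<xi>. (1 + (norm \<xi>)\<^sup>2) powr s * (cmod (g \<xi>))\<^sup>2)}"

definition sobolev_norm :: "real \<Rightarrow> ('d::finite) tdist \<Rightarrow> real" where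
  "sobolev_norm s T = sqrt (\<integral>\<xi>. (1 + (norm \<xi>)\<^sup>2) powr s * (cmod (fhat T \<xi>))\<^sup>2 \<partial>lborel)"

text \<open>The power \<open>(H\<^sup>s)\<^sup>N\<close>: the components carry the indices \<open>0, \<dots>, N - 1\<close>, and the remaining
  entries are 0. Matrices of type \<open>mat\<close> are indexed from 0 as well.\<close>

type_synonym 'd vdist = "nat \<Rightarrow> 'd tdist"

definition sobolev_vec :: "nat \<Rightarrow> real \<Rightarrow> ('d::finite) vdist set" where
  "sobolev_vec N s = {v. (\<forall>i<N. v i \<in> sobolev s) \<and> (\<forall>i\<ge>N. v i = 0)}"

definition sobolev_vec_norm :: "nat \<Rightarrow> real \<Rightarrow> ('d::finite) vdist \<Rightarrow> real" where
  "sobolev_vec_norm N s v = sqrt (\<Sum>i<N. (sobolev_norm s (v i))\<^sup>2)"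

definition scale_vdist :: "complex \<Rightarrow> 'd vdist \<Rightarrow> 'd vdist" where
  "scale_vdist c v = (\<lambda>i \<phi>. c * v i \<phi>)"

definition linear_between ::
  "('d::finite) vdist set \<Rightarrow> 'd vdist set \<Rightarrow> ('d vdist \<Rightarrow> 'd vdist) \<Rightarrow> bool" where
  "linear_between X Y T \<longleftrightarrow> (\<forall>u\<in>X. T u \<in> Y) \<and>
     (\<forall>u\<in>X. \<forall>w\<in>X. T (u + w) = T u + T w) \<and>
     (\<forall>c. \<forall>u\<in>X. T (scale_vdist c u) = scale_vdist c (T u))"

definition continuous_between ::
  "'a::minus set \<Rightarrow> ('a \<Rightarrow> real) \<Rightarrow> 'b::minus set \<Rightarrow> ('b \<Rightarrow> real) \<Rightarrow> ('a \<Rightarrow> 'b) \<Rightarrow> bool" where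
  "continuous_between X nX Y nY T \<longleftrightarrow> (\<forall>u\<in>X. T u \<in> Y) \<and>
     (\<forall>u\<in>X. \<forall>\<epsilon>>0. \<exists>\<delta>>0. \<forall>w\<in>X. nX (w - u) < \<delta> \<longrightarrow> nY (T w - T u) < \<epsilon>)"

definition has_symbol ::
  "nat \<Rightarrow> nat \<Rightarrow> real \<Rightarrow> (('d::finite) vdist \<Rightarrow> 'd vdist) \<Rightarrow> (real^'d \<Rightarrow> complex mat) \<Rightarrow> bool" where
  "has_symbol n m s A M \<longleftrightarrow> (\<forall>\<xi>. M \<xi> \<in> carrier_mat n m) \<and>
     (\<forall>u\<in>sobolev_vec m s. AE \<xi> in lborel. \<forall>i<n.
        fhat (A u i) \<xi> = (\<Sum>j<m. M \<xi> $$ (i, j) * fhat (u j) \<xi>))"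

definition moore_penrose :: "real mat \<Rightarrow> real mat" where
  "moore_penrose N = (THE X. X \<in> carrier_mat (dim_col N) (dim_row N) \<and>
     N * X * N = N \<and> X * N * X = X \<and>
     transpose_mat (N * X) = N * X \<and> transpose_mat (X * N) = X * N)"

text \<open>Coefficients carry an index \<open>(l, j, k)\<close>; they vanish outside \<open>wav_index N J\<close>.\<close>

type_synonym ('d, 'j) coeffs = "nat \<times> 'j \<times> (int^'d) \<Rightarrow> complex"

type_synonym ('d, 'j) wavelets = "nat \<Rightarrow> 'j \<Rightarrow> int^'d \<Rightarrow> 'd tdist"

definition wav_index :: "nat \<Rightarrow> 'j set \<Rightarrow> (nat \<times> 'j \<times> (int^'d::finite)) set" where
  "wav_index N J = {..<N} \<times> J \<times> UNIV"

definition ell2 :: "'j set \<Rightarrow> ('j \<Rightarrow> real) \<Rightarrow> nat \<Rightarrow> real \<Rightarrow> ('d::finite, 'j) coeffs set" where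
  "ell2 J \<alpha> N s = {c. (\<forall>x. x \<notin> wav_index N J \<longrightarrow> c x = 0) \<and>
     (\<lambda>(l, j, k). 2 powr (2 * s * \<alpha> j) * (cmod (c (l, j, k)))\<^sup>2) summable_on wav_index N J}"

definition ell2_norm ::
  "'j set \<Rightarrow> ('j \<Rightarrow> real) \<Rightarrow> nat \<Rightarrow> real \<Rightarrow> ('d::finite, 'j) coeffs \<Rightarrow> real" where
  "ell2_norm J \<alpha> N s c =
     sqrt (\<Sum>\<^sub>\<infinity>(l, j, k)\<in>wav_index N J. 2 powr (2 * s * \<alpha> j) * (cmod (c (l, j, k)))\<^sup>2)"

definition vec_wavelet ::
  "('d::finite, 'j) wavelets \<Rightarrow> nat \<times> 'j \<times> (int^'d) \<Rightarrow> 'd vdist" where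
  "vec_wavelet \<psi> = (\<lambda>(l, j, k) i. if i = l then \<psi> l j k else 0)"

definition wav_sum ::
  "('d::finite, 'j) wavelets \<Rightarrow> ('d, 'j) coeffs \<Rightarrow> (nat \<times> 'j \<times> (int^'d)) set \<Rightarrow> 'd vdist" where
  "wav_sum \<psi> c F = (\<Sum>x\<in>F. scale_vdist (c x) (vec_wavelet \<psi> x))"

text \<open>The series \<open>\<Sum> c\<^sub>x \<Psi>\<^sub>x\<close> converges (unconditionally) to \<open>v\<close> in \<open>(H\<^sup>s)\<^sup>N\<close>.\<close>

definition wav_expands ::
  "'j set \<Rightarrow> ('d::finite, 'j) wavelets \<Rightarrow> nat \<Rightarrow> real \<Rightarrow> ('d, 'j) coeffs \<Rightarrow> 'd vdist \<Rightarrow> bool" where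
  "wav_expands J \<psi> N s c v \<longleftrightarrow>
     ((\<lambda>F. sobolev_vec_norm N s (v - wav_sum \<psi> c F)) \<longlongrightarrow> 0)
       (finite_subsets_at_top (wav_index N J))"

definition wav_dec ::
  "'j set \<Rightarrow> ('j \<Rightarrow> real) \<Rightarrow> ('d::finite, 'j) wavelets \<Rightarrow> nat \<Rightarrow> real \<Rightarrow> 'd vdist \<Rightarrow> ('d, 'j) coeffs"
  where "wav_dec J \<alpha> \<psi> N s v = (THE c. c \<in> ell2 J \<alpha> N s \<and> wav_expands J \<psi> N s c v)"

definition wav_rec ::
  "'j set \<Rightarrow> ('d::finite, 'j) wavelets \<Rightarrow> nat \<Rightarrow> real \<Rightarrow> ('d, 'j) coeffs \<Rightarrow> 'd vdist" where
  "wav_rec J \<psi> N s c = (THE v. v \<in> sobolev_vec N s \<and> wav_expands J \<psi> N s c v)"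

text \<open>Riesz basis of \<open>(H\<^sup>s)\<^sup>N\<close>: decomposition and reconstruction are well defined and continuous
  between \<open>(H\<^sup>s)\<^sup>N\<close> and the weighted sequence space.\<close>

definition riesz_basis ::
  "'j set \<Rightarrow> ('j \<Rightarrow> real) \<Rightarrow> ('d::finite, 'j) wavelets \<Rightarrow> nat \<Rightarrow> real \<Rightarrow> bool" where
  "riesz_basis J \<alpha> \<psi> N s \<longleftrightarrow>
     (\<forall>x\<in>wav_index N J. vec_wavelet \<psi> x \<in> sobolev_vec N s) \<and>
     (\<forall>v\<in>sobolev_vec N s. \<exists>!c. c \<in> ell2 J \<alpha> N s \<and> wav_expands J \<psi> N s c v) \<and>
     (\<forall>c\<in>ell2 J \<alpha> N s. \<exists>!v. v \<in> sobolev_vec N s \<and> wav_expands J \<psi> N s c v) \<and>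
     continuous_between (sobolev_vec N s) (sobolev_vec_norm N s)
       (ell2 J \<alpha> N s) (ell2_norm J \<alpha> N s) (wav_dec J \<alpha> \<psi> N s) \<and>
     continuous_between (ell2 J \<alpha> N s) (ell2_norm J \<alpha> N s)
       (sobolev_vec N s) (sobolev_vec_norm N s) (wav_rec J \<psi> N s)"

text \<open>The closed span \<open>W\<^sub>j\<close> of the wavelets of scale index \<open>j\<close>, and the projector \<open>P\<^sub>j\<close>.\<close>

definition scale_space ::
  "('d::finite, 'j) wavelets \<Rightarrow> nat \<Rightarrow> real \<Rightarrow> 'j \<Rightarrow> 'd vdist set" where
  "scale_space \<psi> N s j = {v\<in>sobolev_vec N s. \<forall>\<epsilon>>0. \<exists>c F.
     finite F \<and> F \<subseteq> wav_index N {j} \<and> sobolev_vec_norm N s (v - wav_sum \<psi> c F) < \<epsilon>}"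

definition scale_proj ::
  "'j set \<Rightarrow> ('j \<Rightarrow> real) \<Rightarrow> ('d::finite, 'j) wavelets \<Rightarrow> nat \<Rightarrow> real \<Rightarrow> 'j \<Rightarrow> 'd vdist \<Rightarrow> 'd vdist"
  where "scale_proj J \<alpha> \<psi> N s j v = wav_rec J \<psi> N s
     (\<lambda>(l, j', k). if j' = j then wav_dec J \<alpha> \<psi> N s v (l, j', k) else 0)"

text \<open>The action of an \<open>m \<times> n\<close> matrix \<open>N\<close> on \<open>W\<^sub>j\<close> through the wavelet coefficients, taking
  values in \<open>(H\<^sup>r)\<^sup>m\<close> for \<open>W\<^sub>j\<close> contained in \<open>(H\<^sup>s)\<^sup>n\<close>.\<close>

definition coeff_action ::
  "'j set \<Rightarrow> ('j \<Rightarrow> real) \<Rightarrow> ('d::finite, 'j) wavelets \<Rightarrow> nat \<Rightarrow> nat \<Rightarrow> real \<Rightarrow> real \<Rightarrow> 'j \<Rightarrow>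
     real mat \<Rightarrow> 'd vdist \<Rightarrow> 'd vdist" where
  "coeff_action J \<alpha> \<psi> n m s r j N v = wav_rec J \<psi> m r
     (\<lambda>(l, j', k). if l < m \<and> j' = j
        then \<Sum>i<n. of_real (N $$ (l, i)) * wav_dec J \<alpha> \<psi> n s v (i, j, k) else 0)"

end

theory Submission
  imports Defs "HOL-Real_Asymp.Real_Asymp"
begin

text \<open>Put \<open>T = Id - A M\<^sub>\<omega>\<^sup>\<dagger>\<close> on the space \<open>H\<^bsup>-t/2\<^esup>\<close>. The almost-orthogonality hypothesis, the bound \<open>\<rho>\<close> on
  each \<open>W\<^sub>j\<close> and the Riesz property give \<open>\<parallel>T v\<parallel> \<le> \<rho> sqrt B K\<^sub>1 K\<^sub>2 \<parallel>v\<parallel>\<close>, where \<open>K\<^sub>1\<close> and \<open>K\<^sub>2\<close>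
  bound decomposition and reconstruction, so \<open>T\<close> is a contraction when \<open>\<rho> < 1 / (sqrt B K\<^sub>1 K\<^sub>2)\<close>.
  The residuals are \<open>v\<^sub>p = T\<^sup>p v\<close>, hence the increments \<open>M\<^sub>\<omega>\<^sup>\<dagger> v\<^sub>p\<close> decay geometrically, \<open>u\<^sub>p\<close> converges
  in the complete coefficient space, and \<open>A u\<^sub>p = v - v\<^sub>p\<close> passes to the limit.

  Since the Sobolev norm is computed from an arbitrarily chosen representative of the Fourier
  transform, even its triangle inequality needs uniqueness of that representative. This is shown by
  testing against Gaussians times products of logistic functions, which approximate indicators of
  orthants.\<close>

section \<open>Uniqueness of the Fourier transform\<close>

definition logistic :: "real \<Rightarrow> real" where
  "logistic y = 1 / (1 + exp (- y))"

lemma logistic_bounds: "0 \<le> logistic y" "logistic y \<le> 1"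
  by (simp_all add: logistic_def add_nonneg_nonneg add_pos_pos divide_le_eq)

text \<open>The logistic function solves \<open>y' = y * (1 - y)\<close>, so its derivatives are
  polynomials in itself; this is what closes \<open>logistic_poly\<close> under
  differentiation.\<close>

lemma logistic_deriv:
  "(logistic has_real_derivative logistic y * (1 - logistic y)) (at y)"
proof -
  have "1 + exp (- y) \<noteq> 0"
    by (smt (verit) exp_gt_zero)
  then show ?thesis
    unfolding logistic_def
    by (auto intro!: derivative_eq_intros simp: divide_simps power2_eq_square)
qed

text \<open>A class of functions of polynomial growth that is closed under partial derivatives.\<close>

inductive_set logistic_poly :: "(real^'d::finite \<Rightarrow> complex) set" where
  const: "(\<lambda>x. c) \<in> logistic_poly"
| coord: "(\<lambda>x. of_real (vec_nth x i)) \<in> logistic_poly"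
| logistic: "(\<lambda>x. of_real (logistic (b * vec_nth x i + c))) \<in> logistic_poly"
| add: "p \<in> logistic_poly \<Longrightarrow> q \<in> logistic_poly \<Longrightarrow> (\<lambda>x. p x + q x) \<in> logistic_poly"
| mult: "p \<in> logistic_poly \<Longrightarrow> q \<in> logistic_poly \<Longrightarrow> (\<lambda>x. p x * q x) \<in> logistic_poly"

lemma logistic_poly_prod:
  "(\<And>i. i \<in> I \<Longrightarrow> p i \<in> logistic_poly) \<Longrightarrow> (\<lambda>x. \<Prod>i\<in>I. p i x) \<in> logistic_poly"
  by (induction I rule: infinite_finite_induct) (simp_all add: logistic_poly.const logistic_poly.mult)

text \<open>Induction over the generation of the class. The full derivative \<open>D x\<close>
  accompanies the claim on its partials because the sum and product rules combine full
  derivatives.\<close>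

lemma logistic_poly_deriv:
  fixes p :: "real^'d::finite \<Rightarrow> complex"
  assumes "p \<in> logistic_poly"
  shows "\<exists>D. (\<forall>x. (p has_derivative D x) (at x)) \<and>
    (\<forall>i. (\<lambda>x. D x (axis i 1)) \<in> logistic_poly)"
  using assms
proof induction
  case (const c)
  show ?case
    by (rule exI[of _ "\<lambda>x h. 0"]) (auto intro: logistic_poly.const)
next
  case (coord i)
  show ?case
  proof (intro exI conjI allI)
    show "((\<lambda>x. complex_of_real (vec_nth x i)) has_derivative
        (\<lambda>h. complex_of_real (vec_nth h i))) (at x)" for x :: "real^'d"
      by (auto intro!: derivative_eq_intros bounded_linear_imp_has_derivative
          bounded_linear_compose[OF bounded_linear_of_real bounded_linear_vec_nth])
  qed (auto simp: axis_def intro: logistic_poly.const)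
next
  case (logistic b i c)
  have L: "((\<lambda>x. b * vec_nth x i + c) has_derivative (\<lambda>h. b * vec_nth h i)) (at x)"
    for x :: "real^'d"
    by (auto intro!: derivative_eq_intros bounded_linear_imp_has_derivative bounded_linear_vec_nth)
  let ?s = "\<lambda>x::real^'d. logistic (b * vec_nth x i + c)"
  show ?case
  proof (intro exI conjI allI)
    fix x :: "real^'d"
    have "(?s has_derivative (\<lambda>h. (b * vec_nth h i) * (?s x * (1 - ?s x)))) (at x)"
      by (rule has_derivative_eq_rhs[OF has_derivative_compose[OF L
              logistic_deriv[unfolded has_field_derivative_def]]]) (auto simp: mult.commute)
    then show "((\<lambda>x. complex_of_real (?s x)) has_derivative
        (\<lambda>h. complex_of_real ((b * vec_nth h i) * (?s x * (1 - ?s x))))) (at x)"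
      by (rule has_derivative_of_real)
  next
    fix k
    have "(\<lambda>x::real^'d. complex_of_real (b * vec_nth (axis k 1 :: real^'d) i) *
        (of_real (?s x) * (1 + (-1) * of_real (?s x)))) \<in> logistic_poly"
      by (intro logistic_poly.intros)
    then show "(\<lambda>x::real^'d. complex_of_real ((b * vec_nth (axis k 1 :: real^'d) i) *
        (?s x * (1 - ?s x)))) \<in> logistic_poly"
      by simp
  qed
next
  case (add p q)
  then obtain D E where
    "\<forall>x. (p has_derivative D x) (at x)" "\<forall>i. (\<lambda>x. D x (axis i 1)) \<in> logistic_poly"
    "\<forall>x. (q has_derivative E x) (at x)" "\<forall>i. (\<lambda>x. E x (axis i 1)) \<in> logistic_poly"
    by blast
  then show ?case
    by (intro exI[of _ "\<lambda>x h. D x h + E x h"])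
      (auto intro!: derivative_intros logistic_poly.add)
next
  case (mult p q)
  then obtain D E where
    "\<forall>x. (p has_derivative D x) (at x)" "\<forall>i. (\<lambda>x. D x (axis i 1)) \<in> logistic_poly"
    "\<forall>x. (q has_derivative E x) (at x)" "\<forall>i. (\<lambda>x. E x (axis i 1)) \<in> logistic_poly"
    by blast
  with mult.hyps show ?case
    by (intro exI[of _ "\<lambda>x h. p x * E x h + D x h * q x"])
      (auto intro!: derivative_intros logistic_poly.add logistic_poly.mult)
qed

text \<open>Since \<open>1 + norm x\<close> is at least 1, two bounds can be raised to the exponent
  \<open>N + N'\<close>, which serves sums and products alike.\<close>

lemma logistic_poly_growth:
  assumes "p \<in> logistic_poly"
  shows "\<exists>C\<ge>0. \<exists>N. \<forall>x. cmod (p x) \<le> C * (1 + norm x) ^ N"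
  using assms
proof induction
  case (const c)
  show ?case
    by (rule exI[of _ "cmod c"]) (auto intro!: exI[of _ 0])
next
  case (coord i)
  show ?case
    by (rule exI[of _ 1]) (auto intro!: exI[of _ 1] order_trans[OF component_le_norm_cart])
next
  case (logistic b i c)
  show ?case
    by (rule exI[of _ 1]) (auto intro!: exI[of _ 0] simp: logistic_bounds)
next
  case (add p q)
  then obtain C N C' N' where b: "C \<ge> 0" "\<And>x. cmod (p x) \<le> C * (1 + norm x) ^ N"
    "C' \<ge> 0" "\<And>x. cmod (q x) \<le> C' * (1 + norm x) ^ N'"
    by blast
  have "cmod (p x + q x) \<le> (C + C') * (1 + norm x) ^ (N + N')" for x
  proof -
    have "C * (1 + norm x) ^ N \<le> C * (1 + norm x) ^ (N + N')"
      "C' * (1 + norm x) ^ N' \<le> C' * (1 + norm x) ^ (N + N')"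
      using b by (auto intro!: mult_left_mono power_increasing)
    then show ?thesis
      using b(2)[of x] b(4)[of x] norm_triangle_ineq[of "p x" "q x"]
      by (simp add: distrib_right)
  qed
  then show ?case
    using b by (intro exI[of _ "C + C'"]) auto
next
  case (mult p q)
  then obtain C N C' N' where b: "C \<ge> 0" "\<And>x. cmod (p x) \<le> C * (1 + norm x) ^ N"
    "C' \<ge> 0" "\<And>x. cmod (q x) \<le> C' * (1 + norm x) ^ N'"
    by blast
  have "cmod (p x * q x) \<le> (C * C') * (1 + norm x) ^ (N + N')" for x
    using mult_mono[OF b(2)[of x] b(4)[of x]] b(1) by (simp add: norm_mult power_add mult_ac)
  then show ?case
    using b by (intro exI[of _ "C * C'"]) auto
qed

definition gauss :: "real^'d::finite \<Rightarrow> real" where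
  "gauss x = exp (- inner x x)"

lemma gauss_deriv:
  "(gauss has_derivative (\<lambda>h. - 2 * inner x h * gauss x)) (at x)"
  unfolding gauss_def
  by (auto intro!: derivative_eq_intros simp: inner_commute algebra_simps)

text \<open>With \<open>r = norm x\<close>, the inequality \<open>1 + r \<le> exp r\<close> leaves
  the exponent \<open>N * r - r^2\<close>, and completing the square bounds it by
  \<open>N^2 / 4\<close>.\<close>

lemma gauss_growth: "(1 + norm x) ^ N * gauss x \<le> exp ((real N)\<^sup>2 / 4)"
proof -
  have "(1 + norm x) ^ N \<le> exp (norm x) ^ N"
    by (intro power_mono) auto
  also have "\<dots> = exp (real N * norm x)"
    by (simp add: exp_of_nat_mult)
  finally have "(1 + norm x) ^ N * gauss x \<le> exp (real N * norm x) * gauss x"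
    by (intro mult_right_mono) (auto simp: gauss_def)
  also have "\<dots> = exp (real N * norm x - (norm x)\<^sup>2)"
    by (simp add: gauss_def exp_diff exp_minus divide_inverse dot_square_norm)
  also have "\<dots> \<le> exp ((real N)\<^sup>2 / 4)"
    using zero_le_power2[of "real N / 2 - norm x"]
    by (simp add: power2_eq_square algebra_simps)
  finally show ?thesis .
qed

text \<open>Differentiating the Gaussian only brings down a factor \<open>-2 * x_i\<close>, which
  stays in the class. Hence products of a class element with the Gaussian are closed under partial
  derivatives.\<close>

lemma logistic_poly_gauss_partial:
  assumes "p \<in> logistic_poly"
  shows "(\<forall>x. (\<lambda>x. p x * of_real (gauss x)) differentiable (at x)) \<and>
    (\<exists>q\<in>logistic_poly. (\<lambda>x. frechet_derivative (\<lambda>x. p x * of_real (gauss x)) (at x) (axis i 1))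
      = (\<lambda>x. q x * of_real (gauss x)))"
proof -
  from logistic_poly_deriv[OF assms] obtain D where D: "\<And>x. (p has_derivative D x) (at x)"
    "\<And>i. (\<lambda>x. D x (axis i 1)) \<in> logistic_poly"
    by blast
  have der: "((\<lambda>x. p x * of_real (gauss x)) has_derivative
     (\<lambda>h. p x * of_real (- 2 * inner x h * gauss x) + D x h * of_real (gauss x))) (at x)" for x
    by (intro has_derivative_mult D has_derivative_of_real gauss_deriv)
  have "(\<lambda>x. D x (axis i 1) + (-2) * (of_real (vec_nth x i) * p x)) \<in> logistic_poly"
    by (intro logistic_poly.intros D assms)
  moreover have "(\<lambda>x. frechet_derivative (\<lambda>x. p x * of_real (gauss x)) (at x) (axis i 1))
      = (\<lambda>x. (D x (axis i 1) + (-2) * (of_real (vec_nth x i) * p x)) * of_real (gauss x))"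
    using frechet_derivative_at[OF der, symmetric] by (auto simp: inner_axis algebra_simps)
  ultimately show ?thesis
    using der by (auto simp: differentiable_def)
qed

text \<open>Every iterated partial derivative is again a class element times the Gaussian, and
  \<open>gauss_growth\<close> absorbs its polynomial growth.\<close>

lemma logistic_poly_gauss_schwartz:
  assumes "p \<in> logistic_poly"
  shows "(\<lambda>x. p x * of_real (gauss x)) \<in> schwartz"
proof -
  have it: "\<exists>q\<in>logistic_poly. iter_partial is (\<lambda>x. p x * of_real (gauss x)) =
      (\<lambda>x. q x * of_real (gauss x))" for "is"
  proof (induction "is")
    case Nil
    then show ?case using assms by auto
  next
    case (Cons i js)
    then obtain q where "q \<in> logistic_poly"
      "iter_partial js (\<lambda>x. p x * of_real (gauss x)) = (\<lambda>x. q x * of_real (gauss x))"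
      by blast
    then show ?case
      using logistic_poly_gauss_partial by auto
  qed
  have "bdd_above (range (\<lambda>x. (1 + norm x) ^ K * cmod (q x * of_real (gauss x))))"
    if q: "q \<in> logistic_poly" for q :: "real^'d::finite \<Rightarrow> complex" and K
  proof -
    from logistic_poly_growth[OF q] obtain C N where
      C: "C \<ge> 0" "\<And>x. cmod (q x) \<le> C * (1 + norm x) ^ N"
      by blast
    have "(1 + norm x) ^ K * cmod (q x * of_real (gauss x)) \<le> C * exp ((real (K + N))\<^sup>2 / 4)" for x
    proof -
      have g: "gauss x \<ge> 0" by (simp add: gauss_def)
      then have "(1 + norm x) ^ K * cmod (q x * of_real (gauss x))
          = cmod (q x) * ((1 + norm x) ^ K * gauss x)"
        by (simp add: norm_mult)
      also have "\<dots> \<le> (C * (1 + norm x) ^ N) * ((1 + norm x) ^ K * gauss x)"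
        using C g by (intro mult_right_mono) auto
      also have "\<dots> = C * ((1 + norm x) ^ (K + N) * gauss x)"
        by (simp add: power_add)
      also have "\<dots> \<le> C * exp ((real (K + N))\<^sup>2 / 4)"
        using C gauss_growth[of x "K + N"] by (intro mult_left_mono) auto
      finally show ?thesis .
    qed
    then show ?thesis
      by (intro bdd_aboveI2)
  qed
  moreover have "(\<lambda>x. q x * of_real (gauss x)) differentiable (at x)"
    if "q \<in> logistic_poly" for q :: "real^'d::finite \<Rightarrow> complex" and x
    using logistic_poly_gauss_partial[OF that] by blast
  ultimately have "(\<forall>x. iter_partial is (\<lambda>x. p x * of_real (gauss x)) differentiable (at x)) \<and>
    (\<forall>N. bdd_above (range (\<lambda>x. (1 + norm x) ^ N *
      cmod (iter_partial is (\<lambda>x. p x * of_real (gauss x)) x))))" for "is"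
    using it[of "is"] by auto
  then show ?thesis
    unfolding schwartz_def by blast
qed

section \<open>Separation of functions by Schwartz functions\<close>

text \<open>The quadratic term decides the limit for nonzero \<delta>; the shift by
  \<open>- real k\<close> sends the value at zero to 0, so the limit is exactly the indicator of the
  open half-line.\<close>

lemma logistic_limit:
  "(\<lambda>k. logistic ((real k)\<^sup>2 * \<delta> - real k)) \<longlonglongrightarrow> (if \<delta> > 0 then 1 else 0)"
proof -
  consider "\<delta> > 0" | "\<delta> = 0" | "\<delta> < 0" by linarith
  then show ?thesis
    unfolding logistic_def by cases (simp_all, real_asymp+)
qed

text \<open>Multiplication by the Gaussian gives an integrable \<open>H\<close>. Its integrals over
  open orthants are limits of tested integrals, hence zero. Orthants form an intersection-stable
  generator of the Borel sets, so every Borel set has integral zero and \<open>H\<close> vanishes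
  almost everywhere.\<close>

lemma schwartz_separates:
  fixes h :: "real^'d::finite \<Rightarrow> complex"
  assumes [measurable]: "h \<in> borel_measurable borel"
    and int: "\<And>\<phi>. \<phi> \<in> schwartz \<Longrightarrow> integrable lborel (\<lambda>x. h x * \<phi> x)"
    and zero: "\<And>\<phi>. \<phi> \<in> schwartz \<Longrightarrow> (\<integral>x. h x * \<phi> x \<partial>lborel) = 0"
  shows "AE x in lborel. h x = 0"
proof -
  define H where "H x = h x * of_real (gauss x)" for x
  let ?E = "range (\<lambda>a. {x::real^'d. \<forall>i. vec_nth a i < vec_nth x i})"
  have g: "(\<lambda>x. of_real (gauss x)) \<in> schwartz"
    using logistic_poly_gauss_schwartz[OF logistic_poly.const[of 1]] by simp
  have H: "integrable lborel H" "integral\<^sup>L lborel H = 0"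
    using int[OF g] zero[OF g] by (simp_all add: H_def[abs_def])
  note [measurable] = borel_measurable_integrable[OF H(1)]
  have sets: "sets lborel = sigma_sets UNIV ?E"
  proof -
    have "?E = range (\<lambda>a::real^'d. {x. eucl_less a x})"
      by (auto simp: eucl_less_def Basis_vec_def inner_axis image_iff)
    then show ?thesis
      by (simp add: borel_eq_greaterThan)
  qed
  have orthant: "set_lebesgue_integral lborel {x. \<forall>i. vec_nth a i < vec_nth x i} H = 0" for a :: "real^'d"
  proof -
    define s where "s k x = (\<Prod>i\<in>UNIV. logistic ((real k)\<^sup>2 * (vec_nth x i - vec_nth a i) - real k))"
      for k :: nat and x :: "real^'d"
    \<comment> \<open>The argument of the logistic function is expanded to the shape
      \<open>b * x_i + c\<close> of \<open>logistic_poly.logistic\<close>.\<close>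
    have "(\<lambda>x. (\<Prod>i\<in>UNIV. of_real (logistic ((real k)\<^sup>2 * vec_nth x i +
        (- (real k)\<^sup>2 * vec_nth a i - real k)))) * of_real (gauss x)) \<in> schwartz" for k
      by (intro logistic_poly_gauss_schwartz logistic_poly_prod logistic_poly.logistic)
    then have sch: "(\<lambda>x. of_real (s k x) * of_real (gauss x)) \<in> schwartz" for k
      by (simp add: s_def algebra_simps)
    have eq: "h x * (of_real (s k x) * of_real (gauss x)) = s k x *\<^sub>R H x" for k x
      by (simp add: H_def scaleR_conv_of_real)
    have int0: "integrable lborel (\<lambda>x. s k x *\<^sub>R H x)" "(\<integral>x. s k x *\<^sub>R H x \<partial>lborel) = 0" for k
      using int[OF sch[of k]] zero[OF sch[of k]] unfolding eq by auto
    have s_lim: "(\<lambda>k. s k x) \<longlonglongrightarrow> indicator {x. \<forall>i. vec_nth a i < vec_nth x i} x" for x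
    proof -
      have "(\<lambda>k. s k x) \<longlonglongrightarrow> (\<Prod>i\<in>UNIV. if vec_nth x i - vec_nth a i > 0 then 1 else 0)"
        unfolding s_def by (intro tendsto_prod logistic_limit)
      also have "(\<Prod>i\<in>UNIV. if vec_nth x i - vec_nth a i > 0 then 1 else 0) =
          (indicator {x. \<forall>i. vec_nth a i < vec_nth x i} x :: real)"
        by (auto simp: indicator_def intro!: prod_zero)
      finally show ?thesis .
    qed
    have "\<bar>s k x\<bar> \<le> 1" for k x
      unfolding s_def abs_prod by (intro prod_le_1) (auto simp: logistic_bounds)
    then have dom: "norm (s k x *\<^sub>R H x) \<le> norm (H x)" for k x
      using mult_left_le_one_le[of "norm (H x)" "\<bar>s k x\<bar>"] by simp
    have [measurable]: "{x. \<forall>i. vec_nth a i < vec_nth x i} \<in> sets borel"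
      using sets by auto
    have "(\<lambda>k. \<integral>x. s k x *\<^sub>R H x \<partial>lborel) \<longlonglongrightarrow>
        (\<integral>x. indicator {x. \<forall>i. vec_nth a i < vec_nth x i} x *\<^sub>R H x \<partial>lborel)"
      using H(1) s_lim dom int0(1)
      by (intro integral_dominated_convergence[where w = "\<lambda>x. norm (H x)"])
        (auto intro!: tendsto_scaleR)
    then show ?thesis
      using int0(2) by (simp add: LIMSEQ_const_iff set_lebesgue_integral_def)
  qed
  have stable: "Int_stable ?E"
  proof (rule Int_stableI_image)
    fix a b :: "real^'d"
    show "\<exists>c\<in>UNIV. {x. \<forall>i. vec_nth a i < vec_nth x i} \<inter> {x. \<forall>i. vec_nth b i < vec_nth x i}
        = {x. \<forall>i. vec_nth c i < vec_nth x i}"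
      by (rule bexI[of _ "\<chi> i. max (vec_nth a i) (vec_nth b i)"]) auto
  qed
  have "set_lebesgue_integral lborel A H = 0" if "A \<in> sigma_sets UNIV ?E" for A
  proof (rule sigma_sets_induct_disjoint[OF stable _ that])
    show "set_lebesgue_integral lborel A H = 0" if "A \<in> ?E" for A
      using that orthant by auto
  next
    fix A assume "A \<in> sigma_sets UNIV ?E" and IH: "set_lebesgue_integral lborel A H = 0"
    then have A: "A \<in> sets lborel" using sets by simp
    then have "set_integrable lborel A H" "set_integrable lborel (- A) H"
      using H(1) by (auto simp: set_integrable_def intro!: integrable_mult_indicator)
    \<comment> \<open>The left side is the total integral of \<open>H\<close>, zero by
      \<open>H(2)\<close>, so the complement inherits the value zero from \<open>A\<close>.\<close>
    then have "set_lebesgue_integral lborel (A \<union> - A) H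
       = set_lebesgue_integral lborel A H + set_lebesgue_integral lborel (- A) H"
      by (intro set_integral_Un) auto
    then show "set_lebesgue_integral lborel (UNIV - A) H = 0"
      using IH H(2) by (simp add: set_lebesgue_integral_def Compl_eq_Diff_UNIV)
  next
    fix A :: "nat \<Rightarrow> (real^'d) set"
    assume A: "disjoint_family A" "range A \<subseteq> sigma_sets UNIV ?E"
      and IH: "\<And>i. set_lebesgue_integral lborel (A i) H = 0"
    have m: "A i \<in> sets lborel" for i using A(2) sets by auto
    have "set_integrable lborel (\<Union>i. A i) H"
      using m H(1) unfolding set_integrable_def by (intro integrable_mult_indicator) auto
    then have "set_lebesgue_integral lborel (\<Union>i. A i) H =
        (\<Sum>i. set_lebesgue_integral lborel (A i) H)"
      using A(1) m by (intro lebesgue_integral_countable_add) (auto simp: disjoint_family_on_def)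
    then show "set_lebesgue_integral lborel (\<Union>i. A i) H = 0" using IH by simp
  qed (simp_all add: set_lebesgue_integral_def)
  then have "AE x in lborel. H x = 0"
    using H(1) sets by (intro sigma_finite_measure.density_unique_banach[OF sigma_finite_lborel]) (auto simp: set_lebesgue_integral_def)
  \<comment> \<open>The Gaussian has no zeros and can be divided out.\<close>
  then show ?thesis
    by eventually_elim (simp add: H_def gauss_def)
qed

text \<open>Tested against any Schwartz function, both candidates give the same value of
  \<open>T\<close>, so the difference is annihilated by all test functions.\<close>

lemma has_fourier_unique:
  assumes "has_fourier T g" "has_fourier T g'"
  shows "AE \<xi> in lborel. g \<xi> = g' \<xi>"
proof -
  have "AE \<xi> in lborel. g \<xi> - g' \<xi> = 0"
    using assms by (intro schwartz_separates) (auto simp: has_fourier_def left_diff_distrib)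
  then show ?thesis by simp
qed

section \<open>Minkowski's inequality in weighted L2 spaces\<close>

text \<open>The defect is a square divided by \<open>a * b\<close>. The right side is linear in the
  two squares, which is what allows it to be integrated termwise.\<close>

lemma sum_square_le:
  fixes x y a b :: real
  assumes "a > 0" "b > 0"
  shows "(x + y)\<^sup>2 \<le> (a + b) * (x\<^sup>2 / a + y\<^sup>2 / b)"
proof -
  have "(a + b) * (x\<^sup>2 / a + y\<^sup>2 / b) - (x + y)\<^sup>2 = (b * x - a * y)\<^sup>2 / (a * b)"
    using assms by (simp add: divide_simps) (simp add: power2_eq_square algebra_simps)
  moreover have "(b * x - a * y)\<^sup>2 / (a * b) \<ge> 0"
    using assms by simp
  ultimately show ?thesis by linarith
qed

text \<open>Minkowski's inequality follows by integrating (or summing) \<open>sum_square_le\<close> and optimising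
  over \<open>a\<close> and \<open>b\<close>.\<close>

lemma sqrt_le_addI:
  fixes a b c :: real
  assumes "a \<ge> 0" "b \<ge> 0"
    and le: "\<And>x y. x > 0 \<Longrightarrow> y > 0 \<Longrightarrow> c \<le> (x + y) * (a\<^sup>2 / x + b\<^sup>2 / y)"
  shows "sqrt c \<le> a + b"
proof (rule field_le_epsilon)
  fix e :: real
  assume e: "e > 0"
  \<comment> \<open>The optimal parameters are \<open>a\<close> and \<open>b\<close>; adding
    \<open>e / 2\<close> keeps the denominators positive when one of them is zero.\<close>
  define x y where "x = a + e / 2" and "y = b + e / 2"
  have xy: "x > 0" "y > 0" "a \<le> x" "b \<le> y"
    using assms e by (auto simp: x_def y_def)
  have "a\<^sup>2 / x \<le> x" "b\<^sup>2 / y \<le> y"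
    using xy assms by (auto simp: divide_le_eq power2_eq_square intro!: mult_mono)
  then have "a\<^sup>2 / x + b\<^sup>2 / y \<le> x + y"
    by (rule add_mono)
  then have "(x + y) * (a\<^sup>2 / x + b\<^sup>2 / y) \<le> (x + y) * (x + y)"
    using xy by (intro mult_left_mono) auto
  with le[OF xy(1,2)] have "c \<le> (x + y) * (x + y)"
    by (rule order_trans)
  then have "sqrt c \<le> sqrt ((x + y)\<^sup>2)"
    unfolding power2_eq_square by (rule real_sqrt_le_mono)
  also have "\<dots> = a + b + e"
    using xy by (simp add: x_def y_def)
  finally show "sqrt c \<le> a + b + e" .
qed

lemma weighted_square_add_le:
  fixes f g :: complex
  assumes "w \<ge> 0" "x > 0" "y > 0"
  shows "w * (cmod (f + g))\<^sup>2 \<le> (x + y) * (w * (cmod f)\<^sup>2 / x + w * (cmod g)\<^sup>2 / y)"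
proof -
  have "(cmod (f + g))\<^sup>2 \<le> (cmod f + cmod g)\<^sup>2"
    by (intro power_mono norm_triangle_ineq) auto
  also have "\<dots> \<le> (x + y) * ((cmod f)\<^sup>2 / x + (cmod g)\<^sup>2 / y)"
    using assms sum_square_le by blast
  finally have "w * (cmod (f + g))\<^sup>2 \<le> w * ((x + y) * ((cmod f)\<^sup>2 / x + (cmod g)\<^sup>2 / y))"
    using assms by (intro mult_left_mono)
  then show ?thesis by (simp add: algebra_simps)
qed

lemma weighted_L2_add:
  fixes f g :: "'a \<Rightarrow> complex" and w :: "'a \<Rightarrow> real"
  assumes [measurable]: "f \<in> borel_measurable M" "g \<in> borel_measurable M" "w \<in> borel_measurable M"
    and w: "\<And>x. w x \<ge> 0"
    and f: "integrable M (\<lambda>x. w x * (cmod (f x))\<^sup>2)"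
    and g: "integrable M (\<lambda>x. w x * (cmod (g x))\<^sup>2)"
  shows "integrable M (\<lambda>x. w x * (cmod (f x + g x))\<^sup>2)"
    and "sqrt (\<integral>x. w x * (cmod (f x + g x))\<^sup>2 \<partial>M) \<le>
      sqrt (\<integral>x. w x * (cmod (f x))\<^sup>2 \<partial>M) + sqrt (\<integral>x. w x * (cmod (g x))\<^sup>2 \<partial>M)"
proof -
  have int: "integrable M (\<lambda>x. (r + t) * (w x * (cmod (f x))\<^sup>2 / r + w x * (cmod (g x))\<^sup>2 / t))" for r t
    using f g by auto
  \<comment> \<open>The parameters 1 and 1 already provide an integrable majorant.\<close>
  show i: "integrable M (\<lambda>x. w x * (cmod (f x + g x))\<^sup>2)"
    by (rule Bochner_Integration.integrable_bound[OF int[of 1 1]])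
      (use w weighted_square_add_le[OF w, of 1 1] in \<open>auto simp: abs_mult intro!: AE_I2 order_trans[OF _ abs_ge_self]\<close>)
  show "sqrt (\<integral>x. w x * (cmod (f x + g x))\<^sup>2 \<partial>M) \<le>
      sqrt (\<integral>x. w x * (cmod (f x))\<^sup>2 \<partial>M) + sqrt (\<integral>x. w x * (cmod (g x))\<^sup>2 \<partial>M)"
  proof (rule sqrt_le_addI)
    fix r t :: real
    assume rt: "r > 0" "t > 0"
    have "(\<integral>x. w x * (cmod (f x + g x))\<^sup>2 \<partial>M) \<le>
        (\<integral>x. (r + t) * (w x * (cmod (f x))\<^sup>2 / r + w x * (cmod (g x))\<^sup>2 / t) \<partial>M)"
      by (rule integral_mono[OF i int]) (intro weighted_square_add_le w rt)
    then show "(\<integral>x. w x * (cmod (f x + g x))\<^sup>2 \<partial>M) \<le>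
        (r + t) * ((sqrt (\<integral>x. w x * (cmod (f x))\<^sup>2 \<partial>M))\<^sup>2 / r +
          (sqrt (\<integral>x. w x * (cmod (g x))\<^sup>2 \<partial>M))\<^sup>2 / t)"
      using f g w by (simp add: integral_nonneg_AE)
  qed (auto simp: integral_nonneg_AE w)
qed

section \<open>Seminormed spaces and bounded homogeneous maps\<close>

text \<open>Carrier, scalar action and norm are explicit, so that Sobolev powers and sequence spaces
  share one theory. It speaks of seminorms because definiteness of the Sobolev norm is only
  recovered from a Riesz basis, in \<open>norm_definite\<close>.\<close>

locale seminormed =
  fixes X :: "'a::ab_group_add set" and sc :: "complex \<Rightarrow> 'a \<Rightarrow> 'a" and nX :: "'a \<Rightarrow> real"
  assumes zero_mem: "0 \<in> X"
    and add_mem: "x \<in> X \<Longrightarrow> y \<in> X \<Longrightarrow> x + y \<in> X"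
    and scale_mem: "x \<in> X \<Longrightarrow> sc c x \<in> X"
    and triangle: "x \<in> X \<Longrightarrow> y \<in> X \<Longrightarrow> nX (x + y) \<le> nX x + nX y"
    and norm_scale: "x \<in> X \<Longrightarrow> nX (sc c x) = cmod c * nX x"
    and scale_minus_one: "sc (- 1) x = - x"
    and scale_zero: "sc 0 x = 0"
    and scale_add: "sc c (x + y) = sc c x + sc c y"
begin

lemma minus_mem: "x \<in> X \<Longrightarrow> - x \<in> X"
  using scale_mem[of x "-1"] by (simp add: scale_minus_one)

lemma diff_mem: "x \<in> X \<Longrightarrow> y \<in> X \<Longrightarrow> x - y \<in> X"
  using add_mem[of x "- y"] minus_mem by simp

lemma sum_mem: "(\<And>i. i \<in> I \<Longrightarrow> f i \<in> X) \<Longrightarrow> sum f I \<in> X"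
  by (induction I rule: infinite_finite_induct) (auto intro: zero_mem add_mem)

lemma norm_zero_eq: "nX 0 = 0"
  using norm_scale[OF zero_mem, of 0] by (simp add: scale_zero)

lemma norm_minus: "x \<in> X \<Longrightarrow> nX (- x) = nX x"
  using norm_scale[of x "-1"] by (simp add: scale_minus_one)

lemma norm_nonneg: "x \<in> X \<Longrightarrow> nX x \<ge> 0"
  using triangle[of x "- x"] by (simp add: minus_mem norm_minus norm_zero_eq)

lemma norm_diff_commute: "x \<in> X \<Longrightarrow> y \<in> X \<Longrightarrow> nX (x - y) = nX (y - x)"
  using norm_minus[of "x - y"] by (simp add: diff_mem)

lemma triangle_diff: "x \<in> X \<Longrightarrow> y \<in> X \<Longrightarrow> nX (x - y) \<le> nX x + nX y"
  using triangle[of x "- y"] by (simp add: minus_mem norm_minus)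

lemma scale_zero_right: "sc c 0 = 0"
  proof -
  have "sc c 0 = sc c 0 + sc c 0"
    using scale_add[of c 0 0] unfolding add_0_right .
  then show ?thesis
    by (rule add_cancel_right_right[THEN iffD1])
qed

lemma scale_minus: "sc c (- x) = - sc c x"
  using scale_add[of c x "- x"] by (simp add: scale_zero_right eq_neg_iff_add_eq_0 add.commute)

lemma scale_diff: "sc c (x - y) = sc c x - sc c y"
  using scale_add[of c x "- y"] by (simp add: scale_minus)

lemma scale_sum: "sc c (sum f I) = (\<Sum>i\<in>I. sc c (f i))"
  by (induction I rule: infinite_finite_induct) (auto simp: scale_zero_right scale_add)

end

text \<open>Continuity at 0 with tolerance 1 yields a radius \<delta>. A point violating the bound
  could be rescaled into that ball while its image has norm 1.\<close>

lemma homogeneous_bounded: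
  fixes T :: "'a::ab_group_add \<Rightarrow> 'b::ab_group_add"
  assumes "seminormed X sX nX" "seminormed Y sY nY"
    and cont: "continuous_between X nX Y nY T"
    and hom: "\<And>c x. x \<in> X \<Longrightarrow> T (sX c x) = sY c (T x)"
  shows "\<exists>K>0. \<forall>x\<in>X. nY (T x) \<le> K * nX x"
proof -
  interpret X: seminormed X sX nX by fact
  interpret Y: seminormed Y sY nY by fact
  have TY: "T x \<in> Y" if "x \<in> X" for x
    using cont that by (auto simp: continuous_between_def)
  have T0: "T 0 = 0"
    using hom[OF X.zero_mem, of 0] by (simp add: X.scale_zero Y.scale_zero)
  obtain \<delta> where \<delta>: "\<delta> > 0" "\<And>w. w \<in> X \<Longrightarrow> nX w < \<delta> \<Longrightarrow> nY (T w) < 1"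
  proof -
    have "\<forall>\<epsilon>>0. \<exists>\<delta>>0. \<forall>w\<in>X. nX (w - 0) < \<delta> \<longrightarrow> nY (T w - T 0) < \<epsilon>"
      using cont X.zero_mem unfolding continuous_between_def by blast
    then have "\<exists>\<delta>>0. \<forall>w\<in>X. nX (w - 0) < \<delta> \<longrightarrow> nY (T w - T 0) < 1"
      by (elim allE[of _ 1]) simp
    then obtain \<delta> where "\<delta> > 0" "\<forall>w\<in>X. nX (w - 0) < \<delta> \<longrightarrow> nY (T w - T 0) < 1"
      by (elim exE conjE)
    then show ?thesis
      using that[of \<delta>] unfolding T0 diff_0_right by simp
  qed
  have "nY (T x) \<le> (2 / \<delta>) * nX x" if x: "x \<in> X" for x
  proof (rule ccontr)
    assume "\<not> ?thesis"
    then have *: "nY (T x) > (2 / \<delta>) * nX x" by simp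
    \<comment> \<open>Normalising by the norm of the image rather than of \<open>x\<close> also
      covers points with \<open>nX x = 0\<close>.\<close>
    define r where "r = 1 / nY (T x)"
    have pos: "nY (T x) > 0"
      using X.norm_nonneg[OF x] \<delta>(1) by (intro le_less_trans[OF _ *]) simp
    then have cr: "cmod (of_real r) = 1 / nY (T x)"
      by (simp add: r_def norm_divide)
    have "nX x < \<delta> * nY (T x)"
      using * \<delta>(1) X.norm_nonneg[OF x] by (simp add: field_simps)
    then have "nX (sX (of_real r) x) < \<delta>"
      using pos unfolding X.norm_scale[OF x] cr by (simp add: divide_less_eq)
    then have "nY (T (sX (of_real r) x)) < 1"
      using \<delta>(2) X.scale_mem x by blast
    moreover have "nY (T (sX (of_real r) x)) = 1"
      using pos unfolding hom[OF x] Y.norm_scale[OF TY[OF x]] cr by simp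
    ultimately show False by simp
  qed
  then show ?thesis
    using \<delta>(1) by (intro exI[of _ "2 / \<delta>"]) auto
qed

section \<open>Sobolev spaces\<close>

lemma schwartz_seminorm_nonneg:
  assumes "\<phi> \<in> schwartz"
  shows "schwartz_seminorm N is \<phi> \<ge> 0"
proof -
  have "bdd_above (range (\<lambda>x. (1 + norm x) ^ N * cmod (iter_partial is \<phi> x)))"
    using assms by (auto simp: schwartz_def)
  then show ?thesis
    unfolding schwartz_seminorm_def by (rule cSUP_upper2[where x = 0]) auto
qed

text \<open>Only seminorms \<open>schwartz_seminorm N\<close> with the same \<open>N\<close> that bounds the number of derivatives
  occur in \<open>tempered\<close>, so both have to be increased together.\<close>

lemma schwartz_seminorm_mono:
  assumes "\<phi> \<in> schwartz" "N \<le> N'"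
  shows "schwartz_seminorm N is \<phi> \<le> schwartz_seminorm N' is \<phi>"
proof -
  have "bdd_above (range (\<lambda>x. (1 + norm x) ^ N' * cmod (iter_partial is \<phi> x)))"
    using assms by (auto simp: schwartz_def)
  then show ?thesis
    unfolding schwartz_seminorm_def using assms(2)
    by (intro cSUP_mono) (auto intro!: exI mult_right_mono power_increasing)
qed

text \<open>Raising the order enlarges each seminorm and adds nonnegative terms; only finitely many
  lists of bounded length exist over a finite index type.\<close>

lemma schwartz_bound_mono:
  fixes \<phi> :: "real^'d::finite \<Rightarrow> complex"
  assumes "\<phi> \<in> schwartz" "N \<le> N'"
  shows "(\<Sum>is\<in>{is. length is \<le> N}. schwartz_seminorm N is \<phi>)
    \<le> (\<Sum>is\<in>{is. length is \<le> N'}. schwartz_seminorm N' is \<phi>)"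
proof -
  have fin: "finite {is :: 'd list. length is \<le> k}" for k
    using finite_lists_length_le[of "UNIV :: 'd set" k] by simp
  have "(\<Sum>is\<in>{is. length is \<le> N}. schwartz_seminorm N is \<phi>)
     \<le> (\<Sum>is\<in>{is. length is \<le> N}. schwartz_seminorm N' is \<phi>)"
    using assms by (intro sum_mono schwartz_seminorm_mono)
  also have "\<dots> \<le> (\<Sum>is\<in>{is. length is \<le> N'}. schwartz_seminorm N' is \<phi>)"
    using assms fin by (intro sum_mono2) (auto intro: schwartz_seminorm_nonneg)
  finally show ?thesis .
qed

lemma tempered_zero: "0 \<in> tempered"
  unfolding tempered_def by (auto intro!: exI[of _ 0])

lemma tempered_bound:
  assumes "T \<in> tempered"
  shows "\<exists>C N. \<forall>\<phi>\<in>schwartz.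
    cmod (T \<phi>) \<le> C * (\<Sum>is\<in>{is. length is \<le> N}. schwartz_seminorm N is \<phi>)"
  using assms by (simp add: tempered_def)

lemma tempered_add:
  assumes "S \<in> tempered" "T \<in> tempered"
  shows "S + T \<in> tempered"
proof -
  obtain C N C' N' where
    S: "\<And>\<phi>. \<phi> \<in> schwartz \<Longrightarrow> cmod (S \<phi>) \<le> C * (\<Sum>is\<in>{is. length is \<le> N}. schwartz_seminorm N is \<phi>)" and
    T: "\<And>\<phi>. \<phi> \<in> schwartz \<Longrightarrow> cmod (T \<phi>) \<le> C' * (\<Sum>is\<in>{is. length is \<le> N'}. schwartz_seminorm N' is \<phi>)"
    using tempered_bound[OF assms(1)] tempered_bound[OF assms(2)] by metis
  \<comment> \<open>The constants in \<open>tempered\<close> may have either sign; their absolute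
    values allow both seminorm sums to be enlarged to a common order.\<close>
  have "cmod ((S + T) \<phi>) \<le> (\<bar>C\<bar> + \<bar>C'\<bar>) *
      (\<Sum>is\<in>{is. length is \<le> max N N'}. schwartz_seminorm (max N N') is \<phi>)"
    (is "_ \<le> _ * ?b (max N N')") if \<phi>: "\<phi> \<in> schwartz" for \<phi>
  proof -
    have pos: "?b k \<ge> 0" for k
      using \<phi> by (intro sum_nonneg schwartz_seminorm_nonneg)
    have "cmod (S \<phi>) \<le> \<bar>C\<bar> * ?b N"
      using S[OF \<phi>] mult_right_mono[OF abs_ge_self pos[of N], of C] by linarith
    also have "\<dots> \<le> \<bar>C\<bar> * ?b (max N N')"
      using \<phi> by (intro mult_left_mono schwartz_bound_mono) auto
    finally have 1: "cmod (S \<phi>) \<le> \<bar>C\<bar> * ?b (max N N')" .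
    have "cmod (T \<phi>) \<le> \<bar>C'\<bar> * ?b N'"
      using T[OF \<phi>] mult_right_mono[OF abs_ge_self pos[of N'], of C'] by linarith
    also have "\<dots> \<le> \<bar>C'\<bar> * ?b (max N N')"
      using \<phi> by (intro mult_left_mono schwartz_bound_mono) auto
    finally have "cmod (T \<phi>) \<le> \<bar>C'\<bar> * ?b (max N N')" .
    then show ?thesis
      using 1 norm_triangle_ineq[of "S \<phi>" "T \<phi>"] by (simp add: distrib_right)
  qed
  then have "\<exists>C N. \<forall>\<phi>\<in>schwartz.
      cmod ((S + T) \<phi>) \<le> C * (\<Sum>is\<in>{is. length is \<le> N}. schwartz_seminorm N is \<phi>)"
    by blast
  moreover have "\<forall>\<phi>. \<phi> \<notin> schwartz \<longrightarrow> (S + T) \<phi> = 0"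
    "\<forall>\<phi>\<in>schwartz. \<forall>\<eta>\<in>schwartz. (S + T) (\<lambda>x. \<phi> x + \<eta> x) = (S + T) \<phi> + (S + T) \<eta>"
    "\<forall>c. \<forall>\<phi>\<in>schwartz. (S + T) (\<lambda>x. c * \<phi> x) = c * (S + T) \<phi>"
    using assms by (auto simp: tempered_def algebra_simps)
  ultimately show ?thesis
    unfolding tempered_def by blast
qed

lemma tempered_scale:
  assumes "T \<in> tempered"
  shows "(\<lambda>\<phi>. c * T \<phi>) \<in> tempered"
proof -
  obtain C N where
    T: "\<And>\<phi>. \<phi> \<in> schwartz \<Longrightarrow> cmod (T \<phi>) \<le> C * (\<Sum>is\<in>{is. length is \<le> N}. schwartz_seminorm N is \<phi>)"
    using tempered_bound[OF assms] by metis
  have "cmod (c * T \<phi>) \<le> (cmod c * C) * (\<Sum>is\<in>{is. length is \<le> N}. schwartz_seminorm N is \<phi>)"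
    if "\<phi> \<in> schwartz" for \<phi>
    using mult_left_mono[OF T[OF that], of "cmod c"] by (simp add: norm_mult mult.assoc)
  then have "\<exists>C N. \<forall>\<phi>\<in>schwartz.
      cmod (c * T \<phi>) \<le> C * (\<Sum>is\<in>{is. length is \<le> N}. schwartz_seminorm N is \<phi>)"
    by blast
  then show ?thesis
    using assms unfolding tempered_def by (auto simp: algebra_simps)
qed

lemma has_fourier_add:
  assumes "has_fourier S f" "has_fourier T g"
  shows "has_fourier (S + T) (\<lambda>\<xi>. f \<xi> + g \<xi>)"
  using assms by (auto simp: has_fourier_def distrib_right)

lemma has_fourier_scale:
  assumes "has_fourier T g"
  shows "has_fourier (\<lambda>\<phi>. c * T \<phi>) (\<lambda>\<xi>. c * g \<xi>)"
  using assms by (auto simp: has_fourier_def mult.assoc)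

lemma has_fourier_zero: "has_fourier 0 (\<lambda>\<xi>. 0)"
  by (simp add: has_fourier_def)

definition sobolev_energy :: "real \<Rightarrow> (real^'d::finite \<Rightarrow> complex) \<Rightarrow> real^'d \<Rightarrow> real" where
  "sobolev_energy s g \<xi> = (1 + (norm \<xi>)\<^sup>2) powr s * (cmod (g \<xi>))\<^sup>2"

lemma sobolev_alt:
  "T \<in> sobolev s \<longleftrightarrow> T \<in> tempered \<and>
    (\<exists>g. has_fourier T g \<and> integrable lborel (sobolev_energy s g))"
  by (simp add: sobolev_def sobolev_energy_def[abs_def])

lemma sobolev_energy_measurable:
  assumes "has_fourier T g"
  shows "sobolev_energy s g \<in> borel_measurable borel"
proof -
  have [measurable]: "g \<in> borel_measurable borel"
    using assms by (simp add: has_fourier_def)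
  show ?thesis
    unfolding sobolev_energy_def[abs_def] by measurable
qed

lemma sobolev_energy_unique:
  assumes "has_fourier T g" "has_fourier T g'"
  shows "integral\<^sup>L lborel (sobolev_energy s g) = integral\<^sup>L lborel (sobolev_energy s g')"
proof -
  have "AE \<xi> in lborel. sobolev_energy s g \<xi> = sobolev_energy s g' \<xi>"
    using has_fourier_unique[OF assms] by eventually_elim (simp add: sobolev_energy_def)
  moreover have "sobolev_energy s g \<in> borel_measurable lborel"
    "sobolev_energy s g' \<in> borel_measurable lborel"
    using sobolev_energy_measurable[OF assms(1)] sobolev_energy_measurable[OF assms(2)] by simp_all
  ultimately show "integral\<^sup>L lborel (sobolev_energy s g) = integral\<^sup>L lborel (sobolev_energy s g')"
    by (intro integral_cong_AE)
qed

text \<open>Removes the arbitrary choice in \<open>fhat\<close>: representatives agree up to null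
  sets, so sums and multiples of distributions can be measured on explicit ones.\<close>

lemma sobolev_norm_eq:
  assumes "has_fourier T g"
  shows "sobolev_norm s T = sqrt (integral\<^sup>L lborel (sobolev_energy s g))"
proof -
  have "has_fourier T (fhat T)"
    unfolding fhat_def using someI[of "has_fourier T", OF assms] .
  then show ?thesis
    using sobolev_energy_unique[OF assms, of "fhat T" s]
    by (simp add: sobolev_norm_def sobolev_energy_def[abs_def])
qed

lemma sobolev_zero: "(0 :: 'd::finite tdist) \<in> sobolev s"
proof -
  have "sobolev_energy s (\<lambda>\<xi>::real^'d. 0) = (\<lambda>\<xi>. 0)"
    by (auto simp: sobolev_energy_def)
  then have "integrable lborel (sobolev_energy s (\<lambda>\<xi>::real^'d. 0))"
    by simp
  then show ?thesis
    using has_fourier_zero tempered_zero unfolding sobolev_alt by blast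
qed

lemma sobolev_add:
  assumes "S \<in> sobolev s" "T \<in> sobolev s"
  shows "S + T \<in> sobolev s" "sobolev_norm s (S + T) \<le> sobolev_norm s S + sobolev_norm s T"
proof -
  obtain f g where f: "has_fourier S f" "integrable lborel (sobolev_energy s f)"
    and g: "has_fourier T g" "integrable lborel (sobolev_energy s g)"
    using assms unfolding sobolev_alt by blast
  have [measurable]: "f \<in> borel_measurable borel" "g \<in> borel_measurable borel"
    using f g by (auto simp: has_fourier_def)
  have "integrable lborel (sobolev_energy s (\<lambda>\<xi>. f \<xi> + g \<xi>)) \<and>
     sqrt (integral\<^sup>L lborel (sobolev_energy s (\<lambda>\<xi>. f \<xi> + g \<xi>))) \<le>
     sqrt (integral\<^sup>L lborel (sobolev_energy s f)) + sqrt (integral\<^sup>L lborel (sobolev_energy s g))"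
    using f(2) g(2) unfolding sobolev_energy_def[abs_def]
    by (intro conjI weighted_L2_add) auto
  moreover note has_fourier_add[OF f(1) g(1)]
  ultimately show "S + T \<in> sobolev s" "sobolev_norm s (S + T) \<le> sobolev_norm s S + sobolev_norm s T"
    using assms tempered_add f g by (auto simp: sobolev_alt sobolev_norm_eq)
qed

lemma sobolev_scale:
  assumes "T \<in> sobolev s"
  shows "(\<lambda>\<phi>. c * T \<phi>) \<in> sobolev s" "sobolev_norm s (\<lambda>\<phi>. c * T \<phi>) = cmod c * sobolev_norm s T"
proof -
  obtain g where g: "has_fourier T g" "integrable lborel (sobolev_energy s g)"
    using assms unfolding sobolev_alt by blast
  have "sobolev_energy s (\<lambda>\<xi>. c * g \<xi>) = (\<lambda>\<xi>. (cmod c)\<^sup>2 * sobolev_energy s g \<xi>)"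
    by (auto simp: sobolev_energy_def norm_mult power_mult_distrib)
  then have "integrable lborel (sobolev_energy s (\<lambda>\<xi>. c * g \<xi>)) \<and>
     sqrt (integral\<^sup>L lborel (sobolev_energy s (\<lambda>\<xi>. c * g \<xi>))) =
     cmod c * sqrt (integral\<^sup>L lborel (sobolev_energy s g))"
    using g(2) by (simp add: real_sqrt_mult)
  moreover note has_fourier_scale[OF g(1), of c]
  ultimately show "(\<lambda>\<phi>. c * T \<phi>) \<in> sobolev s"
    "sobolev_norm s (\<lambda>\<phi>. c * T \<phi>) = cmod c * sobolev_norm s T"
    using assms tempered_scale g by (auto simp: sobolev_alt sobolev_norm_eq)
qed

lemma sobolev_norm_nonneg: "sobolev_norm s T \<ge> 0"
  by (simp add: sobolev_norm_def integral_nonneg_AE)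

lemma seminormed_sobolev_vec:
  "seminormed (sobolev_vec N s) scale_vdist (sobolev_vec_norm N s)"
proof
  fix x y :: "'d::finite vdist" and c
  show "0 \<in> sobolev_vec N s"
    by (auto simp: sobolev_vec_def sobolev_zero)
  show "x \<in> sobolev_vec N s \<Longrightarrow> y \<in> sobolev_vec N s \<Longrightarrow> x + y \<in> sobolev_vec N s"
    by (auto simp: sobolev_vec_def sobolev_add)
  show "x \<in> sobolev_vec N s \<Longrightarrow> scale_vdist c x \<in> sobolev_vec N s"
    by (auto simp: sobolev_vec_def scale_vdist_def sobolev_scale)
  show "sobolev_vec_norm N s (x + y) \<le> sobolev_vec_norm N s x + sobolev_vec_norm N s y"
    if "x \<in> sobolev_vec N s" "y \<in> sobolev_vec N s"
  proof -
    \<comment> \<open>The triangle inequality is applied in each component first, then in the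
      Euclidean norm over the components.\<close>
    have "sobolev_vec_norm N s (x + y) \<le> L2_set (\<lambda>i. sobolev_norm s (x i) + sobolev_norm s (y i)) {..<N}"
      unfolding sobolev_vec_norm_def L2_set_def using that
      by (intro real_sqrt_le_mono sum_mono power_mono)
        (auto simp: sobolev_vec_def sobolev_norm_nonneg intro: sobolev_add)
    also have "\<dots> \<le> sobolev_vec_norm N s x + sobolev_vec_norm N s y"
      using L2_set_triangle_ineq unfolding sobolev_vec_norm_def L2_set_def .
    finally show ?thesis .
  qed
  show "sobolev_vec_norm N s (scale_vdist c x) = cmod c * sobolev_vec_norm N s x"
    if "x \<in> sobolev_vec N s"
  proof -
    have "(\<Sum>i<N. (sobolev_norm s (scale_vdist c x i))\<^sup>2) = (cmod c)\<^sup>2 * (\<Sum>i<N. (sobolev_norm s (x i))\<^sup>2)"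
      using that by (auto simp: sobolev_vec_def scale_vdist_def sobolev_scale power_mult_distrib sum_distrib_left
          intro!: sum.cong)
    then show ?thesis
      by (simp add: sobolev_vec_norm_def real_sqrt_mult)
  qed
qed (auto simp: scale_vdist_def fun_eq_iff distrib_left)

section \<open>Weighted sequence spaces\<close>

text \<open>Projections replace the tuple pattern, so that the term applies to an index that has not
  been split into its three parts.\<close>

definition ell2_term :: "('j \<Rightarrow> real) \<Rightarrow> real \<Rightarrow> ('d, 'j) coeffs \<Rightarrow> nat \<times> 'j \<times> (int^'d) \<Rightarrow> real" where
  "ell2_term \<alpha> s c x = 2 powr (2 * s * \<alpha> (fst (snd x))) * (cmod (c x))\<^sup>2"

lemma ell2_term_eq:
  "(\<lambda>(l, j, k). 2 powr (2 * s * \<alpha> j) * (cmod (c (l, j, k)))\<^sup>2) = ell2_term \<alpha> s c"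
  by (auto simp: ell2_term_def)

lemma ell2_iff:
  "c \<in> ell2 J \<alpha> N s \<longleftrightarrow> (\<forall>x. x \<notin> wav_index N J \<longrightarrow> c x = 0) \<and> ell2_term \<alpha> s c summable_on wav_index N J"
  by (simp add: ell2_def ell2_term_eq)

lemma ell2_zero_outside: "c \<in> ell2 J \<alpha> N s \<Longrightarrow> x \<notin> wav_index N J \<Longrightarrow> c x = 0"
  unfolding ell2_iff by blast

lemma ell2_norm_alt: "ell2_norm J \<alpha> N s c = sqrt (infsum (ell2_term \<alpha> s c) (wav_index N J))"
  by (simp add: ell2_norm_def ell2_term_eq)

lemma ell2_term_nonneg: "ell2_term \<alpha> s c x \<ge> 0"
  by (simp add: ell2_term_def)

lemma ell2_norm_square: "(ell2_norm J \<alpha> N s c)\<^sup>2 = infsum (ell2_term \<alpha> s c) (wav_index N J)"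
  by (simp add: ell2_norm_alt infsum_nonneg ell2_term_nonneg)

lemma ell2_sum_le:
  assumes "c \<in> ell2 J \<alpha> N s" "finite F" "F \<subseteq> wav_index N J"
  shows "sum (ell2_term \<alpha> s c) F \<le> (ell2_norm J \<alpha> N s c)\<^sup>2"
  unfolding ell2_norm_square using assms
  by (intro finite_sum_le_infsum) (auto simp: ell2_iff ell2_term_nonneg)

lemma seminormed_ell2:
  "seminormed (ell2 J \<alpha> N s :: ('d::finite, 'j) coeffs set) (\<lambda>c a x. c * a x) (ell2_norm J \<alpha> N s)"
proof
  fix a b :: "('d, 'j) coeffs" and c :: complex
  let ?W = "wav_index N J :: (nat \<times> 'j \<times> (int^'d)) set"
  have "ell2_term \<alpha> s (0 :: ('d, 'j) coeffs) = (\<lambda>x. 0)"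
    by (auto simp: ell2_term_def)
  then show "(0 :: ('d, 'j) coeffs) \<in> ell2 J \<alpha> N s"
    by (simp add: ell2_iff)
  have scale: "ell2_term \<alpha> s (\<lambda>x. c * a x) = (\<lambda>x. (cmod c)\<^sup>2 * ell2_term \<alpha> s a x)"
    by (auto simp: ell2_term_def norm_mult power_mult_distrib)
  show "(\<lambda>x. c * a x) \<in> ell2 J \<alpha> N s" if "a \<in> ell2 J \<alpha> N s"
    using that by (auto simp: ell2_iff scale intro: summable_on_cmult_right)
  show "ell2_norm J \<alpha> N s (\<lambda>x. c * a x) = cmod c * ell2_norm J \<alpha> N s a"
    by (simp add: ell2_norm_alt scale infsum_cmult_right' real_sqrt_mult)
  assume a: "a \<in> ell2 J \<alpha> N s" and b: "b \<in> ell2 J \<alpha> N s"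
  have s: "ell2_term \<alpha> s a summable_on ?W" "ell2_term \<alpha> s b summable_on ?W"
    using a b by (auto simp: ell2_iff)
  have bound: "((\<lambda>x. (r + t) * (ell2_term \<alpha> s a x / r + ell2_term \<alpha> s b x / t)) has_sum
      (r + t) * (infsum (ell2_term \<alpha> s a) ?W / r + infsum (ell2_term \<alpha> s b) ?W / t)) ?W" for r t
    using s by (simp add: divide_inverse) (intro has_sum_cmult_right has_sum_add has_sum_cmult_left has_sum_infsum)
  have le: "ell2_term \<alpha> s (a + b) x \<le> (r + t) * (ell2_term \<alpha> s a x / r + ell2_term \<alpha> s b x / t)"
    if "r > 0" "t > 0" for r t x
    using weighted_square_add_le[OF _ that] by (simp add: ell2_term_def)
  \<comment> \<open>Summability needs one choice of parameters; the later norm estimate uses all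
    positive ones through \<open>sqrt_le_addI\<close>.\<close>
  have sab: "ell2_term \<alpha> s (a + b) summable_on ?W"
    by (rule summable_on_comparison_test[OF has_sum_imp_summable[OF bound[of 1 1]]])
      (use le[of 1 1] ell2_term_nonneg in auto)
  then show "a + b \<in> ell2 J \<alpha> N s"
    using a b by (auto simp: ell2_iff)
  show "ell2_norm J \<alpha> N s (a + b) \<le> ell2_norm J \<alpha> N s a + ell2_norm J \<alpha> N s b"
    unfolding ell2_norm_alt[of J \<alpha> N s "a + b"]
  proof (rule sqrt_le_addI)
    fix r t :: real
    assume rt: "r > 0" "t > 0"
    show "infsum (ell2_term \<alpha> s (a + b)) ?W \<le>
       (r + t) * ((ell2_norm J \<alpha> N s a)\<^sup>2 / r + (ell2_norm J \<alpha> N s b)\<^sup>2 / t)"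
      unfolding ell2_norm_square
      by (rule has_sum_mono[OF has_sum_infsum[OF sab] bound[of r t] le[OF rt]])
  qed (simp_all add: ell2_norm_alt infsum_nonneg ell2_term_nonneg)
qed (auto simp: fun_eq_iff distrib_left)

text \<open>Geometric increments make every coordinate Cauchy. Estimates over finite index sets pass
  to the coordinatewise limit, and the bound uniform in these sets then controls the norm, as in
  Fatou's lemma.\<close>

lemma ell2_complete:
  fixes a :: "nat \<Rightarrow> ('d::finite, 'j) coeffs"
  assumes mem: "\<And>p. a p \<in> ell2 J \<alpha> N s"
    and step: "\<And>p. ell2_norm J \<alpha> N s (a (Suc p) - a p) \<le> C * q ^ p"
    and q: "0 \<le> q" "q < 1"
  shows "\<exists>c\<in>ell2 J \<alpha> N s. (\<lambda>p. ell2_norm J \<alpha> N s (a p - c)) \<longlonglongrightarrow> 0"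
proof -
  let ?W = "wav_index N J :: (nat \<times> 'j \<times> (int^'d)) set"
  interpret seminormed "ell2 J \<alpha> N s :: ('d, 'j) coeffs set" "\<lambda>c a x. c * a x" "ell2_norm J \<alpha> N s"
    by (rule seminormed_ell2)
  \<comment> \<open>The tail of the geometric series: \<open>e p\<close> is the sum of
    \<open>C * q ^ i\<close> over all \<open>i \<ge> p\<close>.\<close>
  define e where "e p = C / (1 - q) * q ^ p" for p
  have "ell2_norm J \<alpha> N s (a 1 - a 0) \<le> C"
    using step[of 0] by simp
  then have C: "C \<ge> 0"
    using norm_nonneg[OF diff_mem[OF mem[of 1] mem[of 0]]] by linarith
  have e_step: "C * q ^ p + e (Suc p) = e p" for p
    using q by (simp add: e_def divide_simps) (simp add: algebra_simps)
  \<comment> \<open>Subtracting \<open>e (p + r)\<close> makes the induction telescope through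
    \<open>e_step\<close>.\<close>
  have "ell2_norm J \<alpha> N s (a (p + r) - a p) \<le> e p - e (p + r)" for p r
  proof (induction r)
    case 0
    then show ?case by (simp only: add_0_right diff_self norm_zero_eq order_refl)
  next
    case (Suc r)
    have eq: "(a (Suc (p + r)) - a (p + r)) + (a (p + r) - a p) = a (p + Suc r) - a p"
      by simp
    have "ell2_norm J \<alpha> N s ((a (Suc (p + r)) - a (p + r)) + (a (p + r) - a p))
       \<le> ell2_norm J \<alpha> N s (a (Suc (p + r)) - a (p + r)) + ell2_norm J \<alpha> N s (a (p + r) - a p)"
      by (intro triangle diff_mem mem)
    then have "ell2_norm J \<alpha> N s (a (p + Suc r) - a p) \<le> C * q ^ (p + r) + (e p - e (p + r))"
      using Suc.IH step[of "p + r"] unfolding eq by linarith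
    then show ?case
      using e_step[of "p + r"] unfolding add_Suc_right by linarith
  qed
  moreover have "e p \<ge> 0" for p
    using q C by (simp add: e_def)
  ultimately have tail: "ell2_norm J \<alpha> N s (a (p + r) - a p) \<le> e p" for p r
    using order_trans diff_le_eq le_add_same_cancel1 by metis
  have e_lim: "e \<longlonglongrightarrow> 0"
    unfolding e_def using q by (intro tendsto_mult_right_zero LIMSEQ_power_zero) auto
  have ptw: "cmod (c x) \<le> sqrt (1 / 2 powr (2 * s * \<alpha> (fst (snd x)))) * ell2_norm J \<alpha> N s c"
    if "c \<in> ell2 J \<alpha> N s" "x \<in> ?W" for c :: "('d, 'j) coeffs" and x
  proof -
    have "ell2_term \<alpha> s c x \<le> (ell2_norm J \<alpha> N s c)\<^sup>2"
      using ell2_sum_le[OF that(1), of "{x}"] that(2) by simp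
    then have "(cmod (c x))\<^sup>2 \<le> 1 / 2 powr (2 * s * \<alpha> (fst (snd x))) * (ell2_norm J \<alpha> N s c)\<^sup>2"
      by (simp add: ell2_term_def field_simps)
    then have "sqrt ((cmod (c x))\<^sup>2) \<le> sqrt (1 / 2 powr (2 * s * \<alpha> (fst (snd x))) * (ell2_norm J \<alpha> N s c)\<^sup>2)"
      by (rule real_sqrt_le_mono)
    then show ?thesis
      unfolding real_sqrt_mult using norm_nonneg[OF that(1)] by simp
  qed
  have conv: "convergent (\<lambda>p. a p x)" for x
  proof (cases "x \<in> ?W")
    case True
    define w where "w = sqrt (1 / 2 powr (2 * s * \<alpha> (fst (snd x))))"
    have dist: "cmod (a (p + r) x - a p x) \<le> w * e p" for p r
    proof -
      have "cmod ((a (p + r) - a p) x) \<le> w * ell2_norm J \<alpha> N s (a (p + r) - a p)"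
        unfolding w_def by (intro ptw diff_mem mem True)
      also have "\<dots> \<le> w * e p"
        by (intro mult_left_mono tail) (simp add: w_def)
      finally show ?thesis by simp
    qed
    have we: "(\<lambda>p. w * e p) \<longlonglongrightarrow> 0"
      using tendsto_mult_right_zero[OF e_lim] .
    have "Cauchy (\<lambda>p. a p x)"
    proof (rule metric_CauchyI)
      fix \<epsilon> :: real
      assume "\<epsilon> > 0"
      then have "eventually (\<lambda>p. w * e p < \<epsilon> / 2) sequentially"
        using we by (auto dest!: order_tendstoD(2)[where a = "\<epsilon> / 2"])
      then obtain M where M: "w * e M < \<epsilon> / 2"
        by (auto simp: eventually_sequentially)
      have "cmod (a i x - a M x) < \<epsilon> / 2" if "i \<ge> M" for i
        using dist[of M "i - M"] M that by simp
      then show "\<exists>M. \<forall>m\<ge>M. \<forall>n\<ge>M. dist (a m x) (a n x) < \<epsilon>"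
        by (metis dist_norm dist_triangle_half_l)
    qed
    then show ?thesis by (simp add: Cauchy_convergent_iff)
  next
    case False
    then have "a p x = 0" for p
      using mem[of p] ell2_zero_outside by blast
    then show ?thesis by (simp add: convergent_const)
  qed
  define c where "c x = lim (\<lambda>p. a p x)" for x
  have c_lim: "(\<lambda>p. a p x) \<longlonglongrightarrow> c x" for x
    using conv[of x] by (simp add: c_def convergent_LIMSEQ_iff)
  \<comment> \<open>For a fixed finite \<open>F\<close>, the index \<open>r\<close> is sent to
    infinity in a sum of finitely many coordinates.\<close>
  have fin: "sum (ell2_term \<alpha> s (a p - c)) F \<le> (e p)\<^sup>2" if F: "finite F" "F \<subseteq> ?W" for F p
  proof (rule Lim_bounded)
    show "(\<lambda>r. sum (ell2_term \<alpha> s (a p - a r)) F) \<longlonglongrightarrow> sum (ell2_term \<alpha> s (a p - c)) F"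
      unfolding ell2_term_def by (auto intro!: tendsto_intros c_lim)
    show "\<forall>r\<ge>p. sum (ell2_term \<alpha> s (a p - a r)) F \<le> (e p)\<^sup>2"
    proof (intro allI impI)
      fix r assume r: "r \<ge> p"
      have "sum (ell2_term \<alpha> s (a p - a r)) F \<le> (ell2_norm J \<alpha> N s (a p - a r))\<^sup>2"
        by (intro ell2_sum_le diff_mem mem F)
      also have "ell2_norm J \<alpha> N s (a p - a r) = ell2_norm J \<alpha> N s (a r - a p)"
        by (intro norm_diff_commute mem)
      also have "\<dots>\<^sup>2 \<le> (e p)\<^sup>2"
        using tail[of p "r - p"] r by (intro power_mono norm_nonneg diff_mem mem) auto
      finally show "sum (ell2_term \<alpha> s (a p - a r)) F \<le> (e p)\<^sup>2" .
    qed
  qed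
  have c0: "c x = 0" if "x \<notin> ?W" for x
  proof -
    have "a p x = 0" for p
      using mem[of p] that ell2_zero_outside by blast
    then show ?thesis
      using c_lim[of x] by (simp add: LIMSEQ_const_iff)
  qed
  have summ: "ell2_term \<alpha> s (a p - c) summable_on ?W" for p
    using fin by (intro nonneg_bdd_above_summable_on bdd_aboveI[of _ "(e p)\<^sup>2"])
      (auto simp: ell2_term_nonneg)
  have diff: "a p - c \<in> ell2 J \<alpha> N s" for p
    using summ[of p] c0 ell2_zero_outside[OF mem[of p]] unfolding ell2_iff by simp
  \<comment> \<open>Membership of the limit follows from that of its difference to one member of the
    sequence.\<close>
  have "a 0 - (a 0 - c) \<in> ell2 J \<alpha> N s"
    by (intro diff_mem mem diff)
  then have c_mem: "c \<in> ell2 J \<alpha> N s"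
    by simp
  have "ell2_norm J \<alpha> N s (a p - c) \<le> e p" for p
  proof -
    have "infsum (ell2_term \<alpha> s (a p - c)) ?W \<le> (e p)\<^sup>2"
      using summ fin by (rule infsum_le_finite_sums)
    then show ?thesis
      using \<open>e p \<ge> 0\<close> by (simp add: ell2_norm_alt real_le_lsqrt infsum_nonneg ell2_term_nonneg)
  qed
  then have "(\<lambda>p. ell2_norm J \<alpha> N s (a p - c)) \<longlonglongrightarrow> 0"
    using e_lim norm_nonneg[OF diff]
    by (intro tendsto_sandwich[OF _ _ tendsto_const e_lim]) auto
  with c_mem show ?thesis by blast
qed

section \<open>Wavelet Riesz bases\<close>

lemma has_sum_finite_sum:
  fixes f :: "'i \<Rightarrow> 'a \<Rightarrow> real"
  assumes "\<And>i. i \<in> I \<Longrightarrow> (f i has_sum s i) A"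
  shows "((\<lambda>x. \<Sum>i\<in>I. f i x) has_sum (\<Sum>i\<in>I. s i)) A"
  using assms by (induction I rule: infinite_finite_induct) (auto intro: has_sum_add)

text \<open>The projector onto one scale, seen on coefficients; see \<open>proj_eq\<close>.\<close>

definition coeff_trunc :: "'j \<Rightarrow> ('d, 'j) coeffs \<Rightarrow> ('d, 'j) coeffs" where
  "coeff_trunc j c = (\<lambda>(l, j', k). if j' = j then c (l, j', k) else 0)"

lemma ell2_term_trunc:
  "ell2_term \<alpha> s (coeff_trunc j c) x = (if fst (snd x) = j then ell2_term \<alpha> s c x else 0)"
  by (cases x) (simp add: ell2_term_def coeff_trunc_def)

lemma coeff_trunc_mem:
  assumes "c \<in> ell2 J \<alpha> N s"
  shows "coeff_trunc j c \<in> ell2 J \<alpha> N s"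
proof -
  have "ell2_term \<alpha> s c summable_on wav_index N J"
    using assms by (simp add: ell2_iff)
  then have "ell2_term \<alpha> s (coeff_trunc j c) summable_on wav_index N J"
    by (rule summable_on_comparison_test) (simp_all add: ell2_term_trunc ell2_term_nonneg)
  moreover have "coeff_trunc j c x = 0" if "x \<notin> wav_index N J" for x
    using ell2_zero_outside[OF assms that] by (cases x) (auto simp: coeff_trunc_def)
  ultimately show ?thesis
    unfolding ell2_iff by blast
qed

text \<open>Different scales occupy disjoint index sets, so at each index at most one summand
  survives.\<close>

lemma sum_coeff_trunc_le:
  assumes c: "c \<in> ell2 J \<alpha> N s" and F: "finite F"
  shows "(\<Sum>j\<in>F. (ell2_norm J \<alpha> N s (coeff_trunc j c))\<^sup>2) \<le> (ell2_norm J \<alpha> N s c)\<^sup>2"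
proof -
  let ?W = "wav_index N J"
  have s: "ell2_term \<alpha> s (coeff_trunc j c) summable_on ?W" for j
    using coeff_trunc_mem[OF c] by (simp add: ell2_iff)
  have "((\<lambda>x. \<Sum>j\<in>F. ell2_term \<alpha> s (coeff_trunc j c) x) has_sum
      (\<Sum>j\<in>F. infsum (ell2_term \<alpha> s (coeff_trunc j c)) ?W)) ?W"
    by (rule has_sum_finite_sum) (rule has_sum_infsum[OF s])
  moreover have "(ell2_term \<alpha> s c has_sum infsum (ell2_term \<alpha> s c) ?W) ?W"
    using c by (simp add: ell2_iff)
  moreover have "(\<Sum>j\<in>F. ell2_term \<alpha> s (coeff_trunc j c) x) \<le> ell2_term \<alpha> s c x" for x
    using F by (simp add: ell2_term_trunc ell2_term_nonneg)
  ultimately show ?thesis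
    unfolding ell2_norm_square by (rule has_sum_mono)
qed

section \<open>Matrices acting on the coefficients of one scale\<close>

definition coeff_mat ::
  "nat \<Rightarrow> nat \<Rightarrow> 'j \<Rightarrow> real mat \<Rightarrow> ('d, 'j) coeffs \<Rightarrow> ('d, 'j) coeffs" where
  "coeff_mat n m j K c = (\<lambda>(l, j', k). if l < m \<and> j' = j
     then \<Sum>i<n. of_real (K $$ (l, i)) * c (i, j, k) else 0)"

text \<open>The action of a matrix unit: component \<open>i\<close> at scale \<open>j\<close> is
  moved to component \<open>l\<close>, and all else is erased. Any \<open>coeff_mat\<close> is a
  finite combination of these, which reduces membership to a single move.\<close>

definition coeff_move :: "nat \<Rightarrow> nat \<Rightarrow> 'j \<Rightarrow> ('d, 'j) coeffs \<Rightarrow> ('d, 'j) coeffs" where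
  "coeff_move l i j c = (\<lambda>(l', j', k). if l' = l \<and> j' = j then c (i, j, k) else 0)"

lemma coeff_mat_eq_sum:
  fixes c :: "('d::finite, 'j) coeffs"
  shows "coeff_mat n m j K c = (\<Sum>l<m. \<Sum>i<n. (\<lambda>x. of_real (K $$ (l, i)) * coeff_move l i j c x))"
proof
  fix x :: "nat \<times> 'j \<times> (int^'d)"
  obtain l' j' k where x: "x = (l', j', k)"
    by (cases x)
  have app: "(\<Sum>l<m. f l) x = (\<Sum>l<m. f l x)"
    for f :: "nat \<Rightarrow> nat \<times> 'j \<times> (int^'d) \<Rightarrow> complex" and m :: nat
    by (induction m) auto
  have "(\<Sum>l<m. \<Sum>i<n. of_real (K $$ (l, i)) * coeff_move l i j c x) =
      (\<Sum>l<m. if l = l' then \<Sum>i<n. of_real (K $$ (l, i)) * coeff_move l i j c x else 0)"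
    by (rule sum.cong) (auto simp: x coeff_move_def)
  also have "\<dots> = coeff_mat n m j K c x"
    by (simp add: x coeff_mat_def coeff_move_def)
  finally show "coeff_mat n m j K c x =
      (\<Sum>l<m. \<Sum>i<n. (\<lambda>x. of_real (K $$ (l, i)) * coeff_move l i j c x)) x"
    unfolding app by simp
qed

text \<open>On a single scale all weights agree up to a constant factor, so no relation between the
  exponents \<open>s\<close> and \<open>r\<close> is needed.\<close>

lemma coeff_move_mem:
  assumes c: "c \<in> ell2 J \<alpha> n s" and j: "j \<in> J" and "i < n" "l < m"
  shows "coeff_move l i j c \<in> ell2 J \<alpha> m r"
proof -
  define f where "f k = (cmod (c (i, j, k)))\<^sup>2" for k
  have inj: "inj_on (\<lambda>k. (h, j, k)) UNIV" for h :: nat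
    by (auto simp: inj_on_def)
  have "ell2_term \<alpha> s c summable_on (\<lambda>k. (i, j, k)) ` UNIV"
    using c j \<open>i < n\<close> by (auto simp: ell2_iff wav_index_def intro: summable_on_subset_banach)
  then have "(\<lambda>k. 2 powr (2 * s * \<alpha> j) * f k) summable_on UNIV"
    by (simp add: summable_on_reindex[OF inj] o_def ell2_term_def f_def)
  then have "f summable_on UNIV"
    by (simp add: summable_on_cmult_right')
  then have "(\<lambda>k. 2 powr (2 * r * \<alpha> j) * f k) summable_on UNIV"
    by (rule summable_on_cmult_right)
  then have "ell2_term \<alpha> r (coeff_move l i j c) summable_on (\<lambda>k. (l, j, k)) ` UNIV"
    by (simp add: summable_on_reindex[OF inj] o_def ell2_term_def f_def coeff_move_def)
  then have "ell2_term \<alpha> r (coeff_move l i j c) summable_on wav_index m J"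
    using j \<open>l < m\<close>
    by (subst summable_on_cong_neutral[of "(\<lambda>k. (l, j, k)) ` UNIV" "wav_index m J"])
      (auto simp: ell2_term_def coeff_move_def wav_index_def)
  moreover have "coeff_move l i j c x = 0" if "x \<notin> wav_index m J" for x
    using that j \<open>l < m\<close> by (cases x) (auto simp: coeff_move_def wav_index_def)
  ultimately show ?thesis
    unfolding ell2_iff by blast
qed

lemma coeff_mat_mem:
  fixes c :: "('d::finite, 'j) coeffs"
  assumes "c \<in> ell2 J \<alpha> n s" "j \<in> J"
  shows "coeff_mat n m j K c \<in> ell2 J \<alpha> m r"
proof -
  interpret seminormed "ell2 J \<alpha> m r :: ('d, 'j) coeffs set" "\<lambda>c a x. c * a x" "ell2_norm J \<alpha> m r"
    by (rule seminormed_ell2)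
  show ?thesis
    unfolding coeff_mat_eq_sum
    by (intro sum_mem scale_mem coeff_move_mem[OF assms]) auto
qed

lemma coeff_mat_scale:
  "coeff_mat n m j K (\<lambda>x. a * c x) = (\<lambda>x. a * coeff_mat n m j K c x)"
  by (auto simp: coeff_mat_def fun_eq_iff sum_distrib_left mult_ac)

text \<open>In a seminormed space two limits agree only up to norm zero. Membership of the
  approximants is asked eventually, since partial sums lie in the space once their index set is
  admissible.\<close>

lemma (in seminormed) limit_unique:
  assumes x: "x \<in> X" and y: "y \<in> X"
    and f: "eventually (\<lambda>F. f F \<in> X) net" and "net \<noteq> bot"
    and lx: "((\<lambda>F. nX (x - f F)) \<longlongrightarrow> 0) net" and ly: "((\<lambda>F. nX (y - f F)) \<longlongrightarrow> 0) net"
  shows "nX (x - y) = 0"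
proof -
  have "eventually (\<lambda>F. nX (x - y) \<le> nX (x - f F) + nX (y - f F)) net"
    using f
  proof eventually_elim
    case (elim F)
    then have "nX ((x - f F) - (y - f F)) \<le> nX (x - f F) + nX (y - f F)"
      by (intro triangle_diff diff_mem x y)
    then show ?case by simp
  qed
  then have "nX (x - y) \<le> 0 + 0"
    by (rule tendsto_lowerbound[OF tendsto_add[OF lx ly] _ \<open>net \<noteq> bot\<close>])
  then show ?thesis
    using norm_nonneg[OF diff_mem[OF x y]] by simp
qed

lemma eventually_subset_finite_subsets_at_top:
  "eventually (\<lambda>F. finite F \<and> F \<subseteq> A) (finite_subsets_at_top A)"
  by (rule eventually_finite_subsets_at_top_weakI) simp

section \<open>Decomposition and reconstruction for one Riesz basis\<close>

locale wavelet_riesz =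
  fixes J :: "'j set" and \<alpha> :: "'j \<Rightarrow> real" and \<psi> :: "('d::finite, 'j) wavelets"
    and N :: nat and s :: real
  assumes riesz: "riesz_basis J \<alpha> \<psi> N s"
begin

abbreviation X :: "'d vdist set" where "X \<equiv> sobolev_vec N s"
abbreviation nX :: "'d vdist \<Rightarrow> real" where "nX \<equiv> sobolev_vec_norm N s"
abbreviation L :: "('d, 'j) coeffs set" where "L \<equiv> ell2 J \<alpha> N s"
abbreviation nL :: "('d, 'j) coeffs \<Rightarrow> real" where "nL \<equiv> ell2_norm J \<alpha> N s"
abbreviation dec where "dec \<equiv> wav_dec J \<alpha> \<psi> N s"
abbreviation rec where "rec \<equiv> wav_rec J \<psi> N s"
abbreviation expands where "expands \<equiv> wav_expands J \<psi> N s"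

sublocale X: seminormed X scale_vdist nX
  by (rule seminormed_sobolev_vec)

sublocale L: seminormed L "\<lambda>c a x. c * a x" nL
  by (rule seminormed_ell2)

lemma dec_ex1: "v \<in> X \<Longrightarrow> \<exists>!c. c \<in> L \<and> expands c v"
  and rec_ex1: "c \<in> L \<Longrightarrow> \<exists>!v. v \<in> X \<and> expands c v"
  and vec_wavelet_mem: "x \<in> wav_index N J \<Longrightarrow> vec_wavelet \<psi> x \<in> X"
  and dec_continuous: "continuous_between X nX L nL dec"
  and rec_continuous: "continuous_between L nL X nX rec"
  using riesz by (simp_all add: riesz_basis_def)

lemma dec_mem: "v \<in> X \<Longrightarrow> dec v \<in> L"
  and dec_expands: "v \<in> X \<Longrightarrow> expands (dec v) v"
  using theI'[OF dec_ex1] by (simp_all add: wav_dec_def)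

lemma rec_mem: "c \<in> L \<Longrightarrow> rec c \<in> X"
  and rec_expands: "c \<in> L \<Longrightarrow> expands c (rec c)"
  using theI'[OF rec_ex1] by (simp_all add: wav_rec_def)

lemma dec_eqI: "v \<in> X \<Longrightarrow> c \<in> L \<Longrightarrow> expands c v \<Longrightarrow> dec v = c"
  using dec_ex1[of v] dec_mem[of v] dec_expands[of v] by blast

lemma rec_eqI: "v \<in> X \<Longrightarrow> c \<in> L \<Longrightarrow> expands c v \<Longrightarrow> rec c = v"
  using rec_ex1[of c] rec_mem[of c] rec_expands[of c] by blast

lemma rec_dec: "v \<in> X \<Longrightarrow> rec (dec v) = v"
  by (intro rec_eqI dec_mem dec_expands)

lemma dec_rec: "c \<in> L \<Longrightarrow> dec (rec c) = c"
  by (intro dec_eqI rec_mem rec_expands)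

lemma wav_sum_mem: "F \<subseteq> wav_index N J \<Longrightarrow> wav_sum \<psi> c F \<in> X"
  unfolding wav_sum_def by (intro X.sum_mem X.scale_mem vec_wavelet_mem) auto

lemma wav_sum_add: "wav_sum \<psi> (c + d) F = wav_sum \<psi> c F + wav_sum \<psi> d F"
proof -
  have "scale_vdist (a + b) v = scale_vdist a v + scale_vdist b v" for a b and v :: "'d vdist"
    by (auto simp: scale_vdist_def fun_eq_iff distrib_right)
  then show ?thesis
    by (simp add: wav_sum_def sum.distrib)
qed

lemma wav_sum_scale: "wav_sum \<psi> (\<lambda>x. a * c x) F = scale_vdist a (wav_sum \<psi> c F)"
proof -
  have "scale_vdist (a * b) v = scale_vdist a (scale_vdist b v)" for b and v :: "'d vdist"
    by (auto simp: scale_vdist_def fun_eq_iff)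
  then show ?thesis
    by (simp add: wav_sum_def X.scale_sum)
qed

lemma expands_add:
  assumes "v \<in> X" "w \<in> X" "expands c v" "expands d w"
  shows "expands (c + d) (v + w)"
proof -
  let ?net = "finite_subsets_at_top (wav_index N J) :: (nat \<times> 'j \<times> (int^'d)) set filter"
  have lim: "((\<lambda>F. nX (v - wav_sum \<psi> c F) + nX (w - wav_sum \<psi> d F)) \<longlongrightarrow> 0 + 0) ?net"
    using assms(3,4) unfolding wav_expands_def by (intro tendsto_add)
  have "eventually (\<lambda>F. nX ((v + w) - wav_sum \<psi> (c + d) F)
      \<le> nX (v - wav_sum \<psi> c F) + nX (w - wav_sum \<psi> d F)) ?net"
    using eventually_subset_finite_subsets_at_top
  proof eventually_elim
    case (elim F)
    then have "nX ((v - wav_sum \<psi> c F) + (w - wav_sum \<psi> d F))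
        \<le> nX (v - wav_sum \<psi> c F) + nX (w - wav_sum \<psi> d F)"
      by (intro X.triangle X.diff_mem wav_sum_mem assms(1,2)) auto
    then show ?case
      by (simp add: wav_sum_add add_diff_add)
  qed
  moreover have "eventually (\<lambda>F. 0 \<le> nX ((v + w) - wav_sum \<psi> (c + d) F)) ?net"
    using eventually_subset_finite_subsets_at_top
    by eventually_elim (intro X.norm_nonneg X.diff_mem X.add_mem wav_sum_mem assms(1,2), auto)
  ultimately show ?thesis
    unfolding wav_expands_def using lim tendsto_sandwich[OF _ _ tendsto_const] by fastforce
qed

lemma expands_scale:
  assumes "v \<in> X" "expands c v"
  shows "expands (\<lambda>x. a * c x) (scale_vdist a v)"
proof -
  let ?net = "finite_subsets_at_top (wav_index N J) :: (nat \<times> 'j \<times> (int^'d)) set filter"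
  have "((\<lambda>F. cmod a * nX (v - wav_sum \<psi> c F)) \<longlongrightarrow> 0) ?net"
    using assms(2) unfolding wav_expands_def by (rule tendsto_mult_right_zero)
  moreover have "eventually (\<lambda>F. cmod a * nX (v - wav_sum \<psi> c F) =
      nX (scale_vdist a v - wav_sum \<psi> (\<lambda>x. a * c x) F)) ?net"
    using eventually_subset_finite_subsets_at_top
    by eventually_elim
      (simp add: wav_sum_scale X.scale_diff[symmetric] X.norm_scale X.diff_mem wav_sum_mem assms(1))
  ultimately show ?thesis
    unfolding wav_expands_def by (rule Lim_transform_eventually)
qed

text \<open>Linearity of decomposition, and below of reconstruction, comes from uniqueness:
  expansions add and scale, so the combined expansion must be the one selected.\<close>

lemma dec_add: "v \<in> X \<Longrightarrow> w \<in> X \<Longrightarrow> dec (v + w) = dec v + dec w"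
  by (intro dec_eqI expands_add X.add_mem L.add_mem dec_mem dec_expands)

lemma dec_scale: "v \<in> X \<Longrightarrow> dec (scale_vdist a v) = (\<lambda>x. a * dec v x)"
  by (intro dec_eqI expands_scale X.scale_mem L.scale_mem dec_mem dec_expands)

lemma dec_diff: "v \<in> X \<Longrightarrow> w \<in> X \<Longrightarrow> dec (v - w) = dec v - dec w"
  using dec_add[of "v - w" w] by (simp add: X.diff_mem eq_diff_eq)

lemma rec_add: "c \<in> L \<Longrightarrow> d \<in> L \<Longrightarrow> rec (c + d) = rec c + rec d"
  by (intro rec_eqI expands_add X.add_mem L.add_mem rec_mem rec_expands)

lemma rec_scale: "c \<in> L \<Longrightarrow> rec (\<lambda>x. a * c x) = scale_vdist a (rec c)"
  by (intro rec_eqI expands_scale X.scale_mem L.scale_mem rec_mem rec_expands)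

lemma rec_diff: "c \<in> L \<Longrightarrow> d \<in> L \<Longrightarrow> rec (c - d) = rec c - rec d"
  using rec_add[of "c - d" d] by (simp add: L.diff_mem eq_diff_eq)

lemma rec_zero: "rec 0 = 0"
  using rec_add[OF L.zero_mem L.zero_mem] unfolding add_0_right
  by (rule add_cancel_right_right[THEN iffD1])

text \<open>Since elements of norm 0 have the zero coefficients as an expansion, the uniqueness in the
  Riesz property makes the seminorm definite. This replaces injectivity of the Fourier transform
  on distributions; likewise, completeness is inherited from the sequence space.\<close>

lemma norm_definite:
  assumes "v \<in> X" "nX v = 0"
  shows "v = 0"
proof -
  have "wav_sum \<psi> 0 F = 0" for F
    by (simp add: wav_sum_def X.scale_zero)
  then have "expands 0 v"
    using assms(2) by (simp add: wav_expands_def)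
  then have "rec 0 = v"
    by (intro rec_eqI assms L.zero_mem)
  then show ?thesis
    by (simp add: rec_zero)
qed

lemma dec_bounded: "\<exists>K>0. \<forall>v\<in>X. nL (dec v) \<le> K * nX v"
  by (rule homogeneous_bounded[OF X.seminormed_axioms L.seminormed_axioms dec_continuous])
    (rule dec_scale)

lemma rec_bounded: "\<exists>K>0. \<forall>c\<in>L. nX (rec c) \<le> K * nL c"
  by (rule homogeneous_bounded[OF L.seminormed_axioms X.seminormed_axioms rec_continuous])
    (rule rec_scale)

text \<open>Makes the hypothesis on each scale space applicable to the projections of
  \<open>v\<close>.\<close>

lemma rec_trunc_scale_space:
  assumes c: "c \<in> L"
  shows "rec (coeff_trunc j c) \<in> scale_space \<psi> N s j"
proof -
  have t: "coeff_trunc j c \<in> L"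
    using c by (rule coeff_trunc_mem)
  have "\<exists>d F. finite F \<and> F \<subseteq> wav_index N {j} \<and> nX (rec (coeff_trunc j c) - wav_sum \<psi> d F) < \<epsilon>"
    if "\<epsilon> > 0" for \<epsilon>
  proof -
    have "eventually (\<lambda>F. nX (rec (coeff_trunc j c) - wav_sum \<psi> (coeff_trunc j c) F) < \<epsilon>)
        (finite_subsets_at_top (wav_index N J))"
      using rec_expands[OF t] that unfolding wav_expands_def by (rule order_tendstoD(2))
    then obtain F where F: "finite F" "F \<subseteq> wav_index N J"
      "nX (rec (coeff_trunc j c) - wav_sum \<psi> (coeff_trunc j c) F) < \<epsilon>"
      unfolding eventually_finite_subsets_at_top by blast
    \<comment> \<open>Truncated coefficients vanish off scale \<open>j\<close>, so discarding the
      other indices does not change the partial sum.\<close>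
    have "wav_sum \<psi> (coeff_trunc j c) (F \<inter> wav_index N {j}) = wav_sum \<psi> (coeff_trunc j c) F"
      unfolding wav_sum_def
      using F(1,2) by (intro sum.mono_neutral_left)
        (auto simp: coeff_trunc_def wav_index_def X.scale_zero split: if_splits)
    then show ?thesis
      using F by (intro exI[of _ "coeff_trunc j c"] exI[of _ "F \<inter> wav_index N {j}"]) auto
  qed
  then show ?thesis
    using rec_mem[OF t] by (auto simp: scale_space_def)
qed

abbreviation proj where "proj \<equiv> scale_proj J \<alpha> \<psi> N s"

lemma proj_eq: "proj j v = rec (coeff_trunc j (dec v))"
  by (simp add: scale_proj_def coeff_trunc_def)

lemma proj_mem: "v \<in> X \<Longrightarrow> proj j v \<in> X"
  unfolding proj_eq by (intro rec_mem coeff_trunc_mem dec_mem)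

lemma proj_scale:
  assumes "v \<in> X"
  shows "proj j (scale_vdist a v) = scale_vdist a (proj j v)"
proof -
  have "coeff_trunc j (\<lambda>x. a * dec v x) = (\<lambda>x. a * coeff_trunc j (dec v) x)"
    by (auto simp: coeff_trunc_def fun_eq_iff)
  then show ?thesis
    unfolding proj_eq dec_scale[OF assms]
    by (simp add: rec_scale coeff_trunc_mem dec_mem assms)
qed

text \<open>A Bessel-type inequality that replaces orthogonality of the scales: reconstruction costs
  \<open>K2\<close> on each scale, the truncated coefficients sum by disjointness, and decomposition
  costs \<open>K1\<close>.\<close>

lemma proj_square_sum_le:
  assumes dec: "\<And>v. v \<in> X \<Longrightarrow> nL (dec v) \<le> K1 * nX v"
    and rec: "\<And>c. c \<in> L \<Longrightarrow> nX (rec c) \<le> K2 * nL c"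
    and "v \<in> X" "finite F"
  shows "(\<Sum>j\<in>F. (nX (proj j v))\<^sup>2) \<le> (K1 * K2 * nX v)\<^sup>2"
proof -
  have c: "dec v \<in> L"
    using assms(3) by (rule dec_mem)
  have "(\<Sum>j\<in>F. (nX (proj j v))\<^sup>2) \<le> (\<Sum>j\<in>F. (K2 * nL (coeff_trunc j (dec v)))\<^sup>2)"
    unfolding proj_eq using c
    by (intro sum_mono power_mono rec X.norm_nonneg rec_mem coeff_trunc_mem)
  also have "\<dots> = K2\<^sup>2 * (\<Sum>j\<in>F. (nL (coeff_trunc j (dec v)))\<^sup>2)"
    by (simp add: power_mult_distrib sum_distrib_left)
  also have "\<dots> \<le> K2\<^sup>2 * (nL (dec v))\<^sup>2"
    using c assms(4) by (intro mult_left_mono sum_coeff_trunc_le) auto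
  also have "\<dots> \<le> K2\<^sup>2 * (K1 * nX v)\<^sup>2"
    using assms(3) by (intro mult_left_mono power_mono dec L.norm_nonneg c) auto
  finally show ?thesis
    by (simp add: power_mult_distrib mult_ac)
qed

end

section \<open>Convergence of the iteration\<close>

text \<open>\<open>R\<close> is the space of data and residuals, \<open>S\<close> that of the
  unknowns; the exponents will be \<open>- t / 2\<close> and \<open>t / 2\<close>.\<close>

locale wavelet_riesz_pair =
  R: wavelet_riesz J \<alpha> \<psi> n r + S: wavelet_riesz J \<alpha> \<psi> m s
  for J :: "'j set" and \<alpha> :: "'j \<Rightarrow> real" and \<psi> :: "('d::finite, 'j) wavelets"
    and n m :: nat and r s :: real
begin

lemma coeff_action_eq:
  "coeff_action J \<alpha> \<psi> n m r s j K v = S.rec (coeff_mat n m j K (R.dec v))"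
  by (simp add: coeff_action_def coeff_mat_def)

lemma coeff_action_mem:
  "v \<in> R.X \<Longrightarrow> j \<in> J \<Longrightarrow> coeff_action J \<alpha> \<psi> n m r s j K v \<in> S.X"
  unfolding coeff_action_eq by (intro S.rec_mem coeff_mat_mem[OF R.dec_mem])

lemma coeff_action_scale:
  assumes "v \<in> R.X" "j \<in> J"
  shows "coeff_action J \<alpha> \<psi> n m r s j K (scale_vdist a v) =
    scale_vdist a (coeff_action J \<alpha> \<psi> n m r s j K v)"
  unfolding coeff_action_eq R.dec_scale[OF assms(1)] coeff_mat_scale
  by (intro S.rec_scale coeff_mat_mem[OF R.dec_mem] assms)

text \<open>Only homogeneity is needed to turn continuity of \<open>T\<close> into an operator bound.\<close>

lemma multiscale_homogeneous:
  fixes K :: "'j \<Rightarrow> real mat"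
  assumes T: "\<And>v. v \<in> R.X \<Longrightarrow> T v \<in> S.X"
    and lim: "\<And>v. v \<in> R.X \<Longrightarrow>
      ((\<lambda>F. S.nX (T v - (\<Sum>j\<in>F. coeff_action J \<alpha> \<psi> n m r s j (K j) (R.proj j v)))) \<longlongrightarrow> 0)
        (finite_subsets_at_top J)"
    and v: "v \<in> R.X"
  shows "T (scale_vdist a v) = scale_vdist a (T v)"
proof -
  define f where "f F w = (\<Sum>j\<in>F. coeff_action J \<alpha> \<psi> n m r s j (K j) (R.proj j w))" for F w
  have f_mem: "f F w \<in> S.X" if "F \<subseteq> J" "w \<in> R.X" for F w
    unfolding f_def using that by (intro S.X.sum_mem coeff_action_mem R.proj_mem) auto
  have f_scale: "f F (scale_vdist a v) = scale_vdist a (f F v)" if "F \<subseteq> J" for F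
    unfolding f_def S.X.scale_sum using that v
    by (intro sum.cong) (auto simp: R.proj_scale coeff_action_scale R.proj_mem)
  note ev = eventually_subset_finite_subsets_at_top[of J]
  have av: "scale_vdist a v \<in> R.X"
    using v by (rule R.X.scale_mem)
  \<comment> \<open>The partial sums at \<open>scale_vdist a v\<close> are scaled partial sums at
    \<open>v\<close>; they therefore approach both sides of the claim, and uniqueness of limits
    applies.\<close>
  have "((\<lambda>F. cmod a * S.nX (T v - f F v)) \<longlongrightarrow> 0) (finite_subsets_at_top J)"
    using lim[OF v] unfolding f_def by (rule tendsto_mult_right_zero)
  moreover have "eventually (\<lambda>F. cmod a * S.nX (T v - f F v) =
      S.nX (scale_vdist a (T v) - f F (scale_vdist a v))) (finite_subsets_at_top J)"
    using ev by eventually_elim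
      (simp add: f_scale S.X.scale_diff[symmetric] S.X.norm_scale S.X.diff_mem f_mem T v)
  ultimately have "((\<lambda>F. S.nX (scale_vdist a (T v) - f F (scale_vdist a v))) \<longlongrightarrow> 0)
      (finite_subsets_at_top J)"
    by (rule Lim_transform_eventually)
  moreover have "((\<lambda>F. S.nX (T (scale_vdist a v) - f F (scale_vdist a v))) \<longlongrightarrow> 0)
      (finite_subsets_at_top J)"
    using lim[OF av] unfolding f_def .
  moreover have "eventually (\<lambda>F. f F (scale_vdist a v) \<in> S.X) (finite_subsets_at_top J)"
    using ev by eventually_elim (simp add: f_mem av)
  ultimately have "S.nX (T (scale_vdist a v) - scale_vdist a (T v)) = 0"
    using T v av by (intro S.X.limit_unique[where f = "\<lambda>F. f F (scale_vdist a v)"])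
      (auto intro: S.X.scale_mem)
  then have "T (scale_vdist a v) - scale_vdist a (T v) = 0"
    by (intro S.norm_definite S.X.diff_mem S.X.scale_mem T v av)
  then show ?thesis by simp
qed

lemma linear_diff:
  assumes "linear_between S.X R.X A" "x \<in> S.X" "y \<in> S.X"
  shows "A (x - y) = A x - A y"
proof -
  have "A (x + scale_vdist (- 1) y) = A x + scale_vdist (- 1) (A y)"
    using assms S.X.scale_mem unfolding linear_between_def by simp
  then show ?thesis
    by (simp add: S.X.scale_minus_one)
qed

text \<open>\<open>E j w\<close> stands for the residual norm on scale \<open>j\<close> and
  \<open>e\<close> for the full residual norm. The bound on each scale and
  \<open>proj_square_sum_le\<close> control every finite part of the energy sum.\<close>

lemma residual_bound:
  assumes dec: "\<And>v. v \<in> R.X \<Longrightarrow> R.nL (R.dec v) \<le> K1 * R.nX v" "K1 \<ge> 0"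
    and rec: "\<And>c. c \<in> R.L \<Longrightarrow> R.nX (R.rec c) \<le> K2 * R.nL c" "K2 \<ge> 0"
    and B: "B \<ge> 0" and \<rho>: "\<rho> \<ge> 0"
    and E: "\<And>j w. j \<in> J \<Longrightarrow> w \<in> scale_space \<psi> n r j \<Longrightarrow> 0 \<le> E j w \<and> E j w \<le> \<rho> * R.nX w"
    and v: "v \<in> R.X"
    and le: "ennreal (e\<^sup>2) \<le> ennreal B * (\<Sum>\<^sub>\<infinity>j\<in>J. ennreal ((E j (R.proj j v))\<^sup>2))"
  shows "e \<le> \<rho> * (sqrt B * K1 * K2) * R.nX v"
proof -
  let ?b = "\<rho> * (K1 * K2 * R.nX v)"
  have nv: "R.nX v \<ge> 0"
    using v by (rule R.X.norm_nonneg)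
  have fin: "(\<Sum>j\<in>F. (E j (R.proj j v))\<^sup>2) \<le> ?b\<^sup>2" if F: "finite F" "F \<subseteq> J" for F
  proof -
    have sp: "R.proj j v \<in> scale_space \<psi> n r j" for j
      unfolding R.proj_eq by (intro R.rec_trunc_scale_space R.dec_mem v)
    have "(\<Sum>j\<in>F. (E j (R.proj j v))\<^sup>2) \<le> (\<Sum>j\<in>F. (\<rho> * R.nX (R.proj j v))\<^sup>2)"
      using E[OF _ sp] F by (intro sum_mono power_mono) auto
    also have "\<dots> = \<rho>\<^sup>2 * (\<Sum>j\<in>F. (R.nX (R.proj j v))\<^sup>2)"
      by (simp add: power_mult_distrib sum_distrib_left)
    also have "\<dots> \<le> \<rho>\<^sup>2 * (K1 * K2 * R.nX v)\<^sup>2"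
      using F by (intro mult_left_mono R.proj_square_sum_le dec rec v) auto
    finally show ?thesis
      by (simp add: power_mult_distrib)
  qed
  \<comment> \<open>In the extended nonnegative reals the family is always summable, so bounding its
    finite sums suffices.\<close>
  have "(\<Sum>\<^sub>\<infinity>j\<in>J. ennreal ((E j (R.proj j v))\<^sup>2)) \<le> ennreal (?b\<^sup>2)"
  proof (rule infsum_le_finite_sums)
    show "(\<lambda>j. ennreal ((E j (R.proj j v))\<^sup>2)) summable_on J"
      by (rule nonneg_summable_on_complete) simp
    show "(\<Sum>j\<in>F. ennreal ((E j (R.proj j v))\<^sup>2)) \<le> ennreal (?b\<^sup>2)"
      if "finite F" "F \<subseteq> J" for F
      using fin[OF that] by (simp add: sum_ennreal ennreal_leI)
  qed
  then have "ennreal (e\<^sup>2) \<le> ennreal B * ennreal (?b\<^sup>2)"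
    using le by (meson mult_left_mono order_trans zero_le)
  then have "e\<^sup>2 \<le> B * ?b\<^sup>2"
    using B by (simp add: ennreal_mult[symmetric])
  also have "\<dots> = (sqrt B * ?b)\<^sup>2"
    using B by (simp add: power_mult_distrib)
  finally have "e \<le> sqrt B * ?b"
    by (rule power2_le_imp_le)
      (intro mult_nonneg_nonneg real_sqrt_ge_zero B \<rho> dec(2) rec(2) nv)
  then show ?thesis
    by (simp add: mult_ac)
qed

text \<open>Here \<open>T\<close> is the approximate inverse. The contraction
  \<open>x - A (T x)\<close> makes residuals, and hence increments of the iterates, decay
  geometrically; boundedness of \<open>A\<close> carries the residual identity to the limit.\<close>

lemma richardson_converges:
  assumes lin: "linear_between S.X R.X A"
    and contA: "continuous_between S.X S.nX R.X R.nX A"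
    and contT: "continuous_between R.X R.nX S.X S.nX T"
    and homT: "\<And>a v. v \<in> R.X \<Longrightarrow> T (scale_vdist a v) = scale_vdist a (T v)"
    and q: "0 \<le> q" "q < 1"
    and contr: "\<And>v. v \<in> R.X \<Longrightarrow> R.nX (v - A (T v)) \<le> q * R.nX v"
    and v: "v \<in> R.X"
    and u0: "useq 0 = 0" and v0: "vseq 0 = R.dec v"
    and uS: "\<And>p. useq (Suc p) = useq p + S.dec (T (R.rec (vseq p)))"
    and vS: "\<And>p. vseq (Suc p) = vseq p - R.dec (A (S.rec (useq (Suc p) - useq p)))"
  shows "(\<forall>p. useq p \<in> S.L) \<and>
    (\<exists>u\<in>S.X. (\<lambda>p. S.nL (useq p - S.dec u)) \<longlonglongrightarrow> 0 \<and> A u = v)"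
proof -
  \<comment> \<open>The residuals as elements of the Sobolev space; \<open>vseq\<close> turns out to
    list their coefficients.\<close>
  define V where "V p = ((\<lambda>x. x - A (T x)) ^^ p) v" for p
  have A_mem: "A x \<in> R.X" if "x \<in> S.X" for x
    using lin that by (simp add: linear_between_def)
  have T_mem: "T x \<in> S.X" if "x \<in> R.X" for x
    using contT that by (simp add: continuous_between_def)
  have V0: "V 0 = v" and VS: "V (Suc p) = V p - A (T (V p))" for p
    by (simp_all add: V_def)
  have V_mem: "V p \<in> R.X" for p
  proof (induction p)
    case 0
    then show ?case by (simp only: V0 v)
  next
    case (Suc p)
    then show ?case
      unfolding VS by (intro R.X.diff_mem A_mem T_mem)
  qed
  have V_bound: "R.nX (V p) \<le> q ^ p * R.nX v" for p
  proof (induction p)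
    case 0
    then show ?case by (simp add: V0)
  next
    case (Suc p)
    have "R.nX (V (Suc p)) \<le> q * R.nX (V p)"
      unfolding VS by (rule contr[OF V_mem])
    also have "\<dots> \<le> q * (q ^ p * R.nX v)"
      using Suc q by (intro mult_left_mono)
    finally show ?case by (simp add: mult.assoc)
  qed
  have vseq: "vseq p = R.dec (V p)" for p
  proof (induction p)
    case 0
    then show ?case by (simp add: V0 v0)
  next
    case (Suc p)
    have "useq (Suc p) - useq p = S.dec (T (V p))"
      unfolding uS Suc by (simp add: R.rec_dec V_mem)
    then have "vseq (Suc p) = R.dec (V p) - R.dec (A (T (V p)))"
      unfolding vS Suc by (simp only: S.rec_dec[OF T_mem[OF V_mem]])
    then show ?case
      unfolding VS by (simp only: R.dec_diff[OF V_mem A_mem[OF T_mem[OF V_mem]]])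
  qed
  have useq: "useq (Suc p) = useq p + S.dec (T (V p))" for p
    unfolding uS vseq by (simp only: R.rec_dec[OF V_mem])
  have dT_mem: "S.dec (T (V p)) \<in> S.L" for p
    by (intro S.dec_mem T_mem V_mem)
  have u_mem: "useq p \<in> S.L" for p
    by (induction p) (auto simp only: u0 useq intro: S.L.zero_mem S.L.add_mem dT_mem)
  have A0: "A 0 = 0"
    using linear_diff[OF lin S.X.zero_mem S.X.zero_mem] by simp
  \<comment> \<open>The invariant of the iteration: what \<open>A\<close> gains on the iterate is
    exactly what the residual loses.\<close>
  have split: "A (S.rec (useq p)) + V p = v" for p
  proof (induction p)
    case 0
    then show ?case by (simp only: u0 V0 S.rec_zero A0 add_0_left)
  next
    case (Suc p)
    have "S.rec (useq (Suc p)) = S.rec (useq p) + T (V p)"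
      unfolding useq S.rec_add[OF u_mem dT_mem] by (simp only: S.rec_dec[OF T_mem[OF V_mem]])
    then have "A (S.rec (useq (Suc p))) = A (S.rec (useq p)) + A (T (V p))"
      using lin S.rec_mem[OF u_mem] T_mem[OF V_mem] unfolding linear_between_def by simp
    then show ?case
      using Suc by (simp add: VS)
  qed
  obtain KA where KA: "KA > 0" "\<And>x. x \<in> S.X \<Longrightarrow> R.nX (A x) \<le> KA * S.nX x"
  proof -
    have "\<exists>K>0. \<forall>x\<in>S.X. R.nX (A x) \<le> K * S.nX x"
      by (rule homogeneous_bounded[OF S.X.seminormed_axioms R.X.seminormed_axioms contA])
        (use lin in \<open>simp add: linear_between_def\<close>)
    then show ?thesis using that by blast
  qed
  obtain KT where KT: "KT > 0" "\<And>x. x \<in> R.X \<Longrightarrow> S.nX (T x) \<le> KT * R.nX x"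
  proof -
    have "\<exists>K>0. \<forall>x\<in>R.X. S.nX (T x) \<le> K * R.nX x"
      by (rule homogeneous_bounded[OF R.X.seminormed_axioms S.X.seminormed_axioms contT]) (rule homT)
    then show ?thesis using that by blast
  qed
  obtain KD where KD: "KD > 0" "\<And>x. x \<in> S.X \<Longrightarrow> S.nL (S.dec x) \<le> KD * S.nX x"
    using S.dec_bounded by blast
  obtain KR where KR: "KR > 0" "\<And>c. c \<in> S.L \<Longrightarrow> S.nX (S.rec c) \<le> KR * S.nL c"
    using S.rec_bounded by blast
  have "S.nL (useq (Suc p) - useq p) \<le> (KD * KT * R.nX v) * q ^ p" for p
  proof -
    have "useq (Suc p) - useq p = S.dec (T (V p))"
      unfolding useq by simp
    then have "S.nL (useq (Suc p) - useq p) \<le> KD * S.nX (T (V p))"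
      by (simp only: KD(2)[OF T_mem[OF V_mem]])
    also have "\<dots> \<le> KD * (KT * R.nX (V p))"
      using KD(1) by (intro mult_left_mono KT(2) V_mem) simp
    also have "\<dots> \<le> KD * (KT * (q ^ p * R.nX v))"
      using KD(1) KT(1) by (intro mult_left_mono V_bound) auto
    finally show ?thesis by (simp add: mult_ac)
  qed
  from ell2_complete[OF u_mem this q] obtain c where
    c: "c \<in> S.L" "(\<lambda>p. S.nL (useq p - c)) \<longlonglongrightarrow> 0"
    by blast
  have cu: "S.rec c \<in> S.X"
    using c(1) by (rule S.rec_mem)
  \<comment> \<open>The left side does not depend on \<open>p\<close>, while the right side tends to
    zero, so the residual of the limit has norm zero.\<close>
  have le: "R.nX (v - A (S.rec c)) \<le> q ^ p * R.nX v + KA * (KR * S.nL (useq p - c))" for p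
  proof -
    have d: "useq p - c \<in> S.L"
      by (intro S.L.diff_mem u_mem c)
    have "v - A (S.rec c) = V p + (A (S.rec (useq p)) - A (S.rec c))"
      unfolding split[of p, symmetric] by simp
    also have "A (S.rec (useq p)) - A (S.rec c) = A (S.rec (useq p - c))"
      unfolding S.rec_diff[OF u_mem c(1)]
      by (simp only: linear_diff[OF lin S.rec_mem[OF u_mem] cu])
    finally have eq: "v - A (S.rec c) = V p + A (S.rec (useq p - c))" .
    have "R.nX (v - A (S.rec c)) \<le> R.nX (V p) + R.nX (A (S.rec (useq p - c)))"
      unfolding eq by (rule R.X.triangle[OF V_mem A_mem[OF S.rec_mem[OF d]]])
    also have "R.nX (A (S.rec (useq p - c))) \<le> KA * S.nX (S.rec (useq p - c))"
      by (intro KA S.rec_mem d)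
    also have "\<dots> \<le> KA * (KR * S.nL (useq p - c))"
      using KA(1) by (intro mult_left_mono KR(2) d) simp
    finally show ?thesis
      using V_bound[of p] by linarith
  qed
  have "(\<lambda>p. q ^ p * R.nX v + KA * (KR * S.nL (useq p - c))) \<longlonglongrightarrow> 0 * R.nX v + KA * (KR * 0)"
    using q by (intro tendsto_intros c(2) LIMSEQ_power_zero) auto
  then have "R.nX (v - A (S.rec c)) \<le> 0"
    using le by (intro tendsto_lowerbound[where F = sequentially]) auto
  then have "v - A (S.rec c) = 0"
    using R.X.norm_nonneg[OF R.X.diff_mem[OF v A_mem[OF cu]]]
    by (intro R.norm_definite R.X.diff_mem v A_mem cu) simp
  then have "A (S.rec c) = v" by simp
  then show ?thesis
    using u_mem cu c S.dec_rec[OF c(1)] by (intro conjI allI bexI[of _ "S.rec c"]) simp_all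
qed

end

text \<open>The order of quantifiers expresses the dependence of the threshold:
  \<open>\<rho>\<^sub>0\<close> is chosen before \<open>m\<close>, the operator and the matrices.
  The energy sum is taken in the extended nonnegative reals, so that it may be infinite.\<close>

theorem theorem4p1:
  fixes n :: nat and t B :: real
    and J :: "'j set" and \<alpha> :: "'j \<Rightarrow> real"
    and \<psi> :: "('d::finite, 'j) wavelets"
  assumes "n \<ge> 1" and "countable J" and "B > 0"
    and "riesz_basis J \<alpha> \<psi> n (- t / 2)"
  shows "\<exists>\<rho>\<^sub>0>0. \<forall>(m::nat) A M M\<^sub>\<omega> Mdag \<rho>.
    m \<ge> 1 \<longrightarrow>
    riesz_basis J \<alpha> \<psi> m (t / 2) \<longrightarrow>
    linear_between (sobolev_vec m (t / 2)) (sobolev_vec n (- t / 2)) A \<longrightarrow>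
    continuous_between (sobolev_vec m (t / 2)) (sobolev_vec_norm m (t / 2))
      (sobolev_vec n (- t / 2)) (sobolev_vec_norm n (- t / 2)) A \<longrightarrow>
    has_symbol n m (t / 2) A M \<longrightarrow>
    (\<forall>j\<in>J. M\<^sub>\<omega> j \<in> carrier_mat n m) \<longrightarrow>
    (let P = scale_proj J \<alpha> \<psi> n (- t / 2);
         Mdag_at = (\<lambda>j. coeff_action J \<alpha> \<psi> n m (- t / 2) (t / 2) j (moore_penrose (M\<^sub>\<omega> j)));
         A_seq = (\<lambda>c. wav_dec J \<alpha> \<psi> n (- t / 2) (A (wav_rec J \<psi> m (t / 2) c)));
         Mdag_seq = (\<lambda>c. wav_dec J \<alpha> \<psi> m (t / 2) (Mdag (wav_rec J \<psi> n (- t / 2) c)))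
     in
      (\<forall>v\<in>sobolev_vec n (- t / 2).
        ((\<lambda>F. sobolev_vec_norm m (t / 2) (Mdag v - (\<Sum>j\<in>F. Mdag_at j (P j v)))) \<longlongrightarrow> 0)
          (finite_subsets_at_top J)) \<longrightarrow>
      continuous_between (sobolev_vec n (- t / 2)) (sobolev_vec_norm n (- t / 2))
        (sobolev_vec m (t / 2)) (sobolev_vec_norm m (t / 2)) Mdag \<longrightarrow>
      (\<forall>v\<in>sobolev_vec n (- t / 2).
        ennreal ((sobolev_vec_norm n (- t / 2) (v - A (Mdag v)))\<^sup>2)
          \<le> ennreal B * (\<Sum>\<^sub>\<infinity>j\<in>J.
              ennreal ((sobolev_vec_norm n (- t / 2) (P j v - A (Mdag_at j (P j v))))\<^sup>2))) \<longrightarrow>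
      \<rho> \<ge> 0 \<longrightarrow>
      (\<forall>j\<in>J. \<forall>w\<in>scale_space \<psi> n (- t / 2) j.
        sobolev_vec_norm n (- t / 2) (w - A (Mdag_at j w))
          \<le> \<rho> * sobolev_vec_norm n (- t / 2) w) \<longrightarrow>
      \<rho> < \<rho>\<^sub>0 \<longrightarrow>
      (\<forall>v\<in>sobolev_vec n (- t / 2). \<forall>useq vseq.
        useq 0 = 0 \<longrightarrow>
        vseq 0 = wav_dec J \<alpha> \<psi> n (- t / 2) v \<longrightarrow>
        (\<forall>p. useq (Suc p) = useq p + Mdag_seq (vseq p)) \<longrightarrow>
        (\<forall>p. vseq (Suc p) = vseq p - A_seq (useq (Suc p) - useq p)) \<longrightarrow>
        (\<forall>p. useq p \<in> ell2 J \<alpha> m (t / 2)) \<and>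
        (\<exists>u\<in>sobolev_vec m (t / 2).
          (\<lambda>p. ell2_norm J \<alpha> m (t / 2) (useq p - wav_dec J \<alpha> \<psi> m (t / 2) u)) \<longlonglongrightarrow> 0 \<and>
          A_seq (wav_dec J \<alpha> \<psi> m (t / 2) u) = wav_dec J \<alpha> \<psi> n (- t / 2) v \<and>
          A u = v)))"
proof -
  interpret R: wavelet_riesz J \<alpha> \<psi> n "- t / 2"
    by (rule wavelet_riesz.intro) fact
  obtain K1 where K1: "K1 > 0" "\<And>v. v \<in> R.X \<Longrightarrow> R.nL (R.dec v) \<le> K1 * R.nX v"
    using R.dec_bounded by blast
  obtain K2 where K2: "K2 > 0" "\<And>c. c \<in> R.L \<Longrightarrow> R.nX (R.rec c) \<le> K2 * R.nL c"
    using R.rec_bounded by blast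
  \<comment> \<open>\<open>K1\<close> and \<open>K2\<close> belong to the basis of the data space
    alone. The residual operator has bound \<rho> times \<open>?k\<close>, so \<open>1 / ?k\<close>
    is the threshold below which it contracts.\<close>
  let ?k = "sqrt B * K1 * K2"
  have k: "?k > 0"
    using \<open>B > 0\<close> K1 K2 by simp
  show ?thesis
    unfolding Let_def
  proof (rule exI[of _ "1 / ?k"], rule conjI, goal_cases)
    case 1
    show ?case using k by simp
  next
    case 2
    show ?case
    proof (intro allI impI ballI, goal_cases)
      case prems: (1 m A M K T \<rho> v useq vseq)
      interpret wavelet_riesz_pair J \<alpha> \<psi> n m "- t / 2" "t / 2"
        by (intro wavelet_riesz_pair.intro R.wavelet_riesz_axioms wavelet_riesz.intro prems(2))
      note lin = prems(3) and contA = prems(4) and lim = prems(7) and contT = prems(8)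
        and energy = prems(9) and \<rho> = prems(10) and scale = prems(11)
      have A_mem: "A x \<in> R.X" if "x \<in> S.X" for x
        using lin that by (simp add: linear_between_def)
      have T_mem: "T x \<in> S.X" if "x \<in> R.X" for x
        using contT that by (simp add: continuous_between_def)
      have hom: "T (scale_vdist a w) = scale_vdist a (T w)" if "w \<in> R.X" for a w
        by (rule multiscale_homogeneous[OF T_mem bspec[OF lim] that])
      define E where "E j w = R.nX (w - A (coeff_action J \<alpha> \<psi> n m (- t / 2) (t / 2) j
          (moore_penrose (K j)) w))" for j w
      have contr: "R.nX (w - A (T w)) \<le> \<rho> * ?k * R.nX w" if w: "w \<in> R.X" for w
      \<comment> \<open>The almost-orthogonality hypothesis, rewritten with \<open>E\<close>, is the
        energy inequality that \<open>residual_bound\<close> expects.\<close>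
      proof (rule residual_bound[where E = E, OF K1(2) _ K2(2) _ _ \<rho> _ w
          bspec[OF energy w, folded E_def]])
        fix j w
        assume j: "j \<in> J" and sp: "w \<in> scale_space \<psi> n (- t / 2) j"
        then have "w \<in> R.X"
          by (simp add: scale_space_def)
        then have "w - A (coeff_action J \<alpha> \<psi> n m (- t / 2) (t / 2) j (moore_penrose (K j)) w) \<in> R.X"
          by (intro R.X.diff_mem A_mem coeff_action_mem j)
        then show "0 \<le> E j w \<and> E j w \<le> \<rho> * R.nX w"
          unfolding E_def by (intro conjI bspec[OF bspec[OF scale j] sp] R.X.norm_nonneg)
      qed (use K1 K2 \<open>B > 0\<close> in auto)
      have q: "0 \<le> \<rho> * ?k" "\<rho> * ?k < 1"
        using k \<rho> prems(12) by (simp_all add: less_divide_eq)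
      have "(\<forall>p. useq p \<in> S.L) \<and>
          (\<exists>u\<in>S.X. (\<lambda>p. S.nL (useq p - S.dec u)) \<longlonglongrightarrow> 0 \<and> A u = v)"
        by (rule richardson_converges[OF lin contA contT hom q contr prems(13,14,15)
              prems(16)[rule_format] prems(17)[rule_format]])
      then obtain u where mem: "\<forall>p. useq p \<in> S.L"
        and u: "u \<in> S.X" "(\<lambda>p. S.nL (useq p - S.dec u)) \<longlonglongrightarrow> 0" "A u = v"
        by (elim conjE bexE)
      from u(3) have "R.dec (A (S.rec (S.dec u))) = R.dec v"
        by (simp only: S.rec_dec[OF u(1)])
      with mem u show ?case
        by (intro conjI bexI[of _ u])
    qed
  qed
qed

end
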